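(* For a permutation $\pi$ of $q$ symbols let $(I_{min}^*, F_\pi^* )$ be the minimal subset of the aperiodic Cantor system $(I_{np}^*,F_\pi^* )$ of the rotated odometer $F_\pi$. Then: (1) There exist infinitely many $q \geq 3$, and permutations $\pi$ of $q$ symbols, such that the minimal system $(I_{min}^*, F_\pi^* )$ has the dyadic odometer as a factor. (2) There exist infinitely many $q \geq 3$, and permutations $\pi$ of $q$ symbols, such that the minimal system $(I_{min}^*, F_\pi^* )$ does not factor to the dyadic odometer, and is not weakly mixing.
   Context: Rotated odometer: let $I=[0,1)$. The von Neumann–Kakutani map $\mathfrak a: I\to I$ is $\mathfrak a(x)=x-(1-3\cdot 2^{-n})$ for $x\in[1-2^{1-n},1-2^{-n})$, $n\ge 1$. For a permutation $\pi$ of $\{0,\dots,q-1\}$, $R_\pi:I\to I$ maps each $[\frac iq,\frac{i+1}q)$ by a translation onto $[\frac{\pi(i)}q,\frac{\pi(i)+1}q)$, and $F_\pi=\mathfrak a\circ R_\pi$. $I_{per}$ is the set of $F_\pi$-periodic points in $I$, $I_{np}=I\setminus I_{per}$. The map $F_\pi$ is injective and its range is $(0,1)$. Compactification: let $D_0\subset I$ consist of $0$, the points $R_\pi^{-1}(1-2^{-n})$, $n\ge0$, and all discontinuity points of $F_\pi$. Let $D$ be the union of the forward orbits of the points of $D_0$ and the backward orbits of the points of $D_0\setminus\{0\}$ under $F_\pi$. For each $x\in D\setminus\{0\}$ add a new point $x^-$; write $x^+:=x$ for $x\in D$, and $1^-:=1$. Set $I^*=I\cup\{x^-:x\in D\setminus\{0\}\}\cup\{1\}$,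 ordered by extending the order of $[0,1]$ so that $x^-$ is the immediate predecessor of $x^+$, and give $I^*$ the order topology. Let $\widehat x=\lim_{y\nearrow1}R_\pi^{-1}(y)\in(0,1]$. Define $F_\pi^*:I^*\to I^*$ by $F_\pi^*=F_\pi$ on $I$, $F_\pi^*(\widehat x^-)=0$, and $F^*_\pi(z^-)=\lim_{y\nearrow z}F_\pi(y)$ (limit in $I^*$) for all other added points $z^-$, $z\in (D\setminus\{0\})\cup\{1\}$. Let $I_{per}^*$ be the union of all order intervals $[x^+,y^-]\subset I^*$ with $x\in D$, $y\in D\cup\{1\}$, $[x,y)\subset I_{per}$, and $I_{np}^*=I^*\setminus I_{per}^*$. $I_{min}^*$ denotes the unique minimal set (non-empty, closed, invariant, with no proper such subset) of $(I_{np}^*,F_\pi^* )$; the system $(I^*_{min},F_\pi^* )$ is uniquely ergodic. The dyadic odometer is addition of $1$ with carry on $\{0,1\}^{\mathbb N}$ (equivalently $x\mapsto x+1$ on the $2$-adic integers), with Haar measure. "Factor" may be read either as topological factor or as measure-theoretical factor with respect to the unique invariant probability measure on $I^*_{min}$ (for these systems the two notions of rotational factors coincide by a theorem of Host). Weak mixing is with respect to this measure. *)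

theory Defs
  imports "HOL-Probability.Probability"
begin

definition topological_factor ::
    "'a topology \<Rightarrow> ('a \<Rightarrow> 'a) \<Rightarrow> 'b topology \<Rightarrow> ('b \<Rightarrow> 'b) \<Rightarrow> bool" where
  "topological_factor X f Y g \<longleftrightarrow>
     (\<exists>h. continuous_map X Y h \<and> h ` topspace X = topspace Y \<and>
          (\<forall>x\<in>topspace X. h (f x) = g (h x)))"

definition minimal_set :: "'a topology \<Rightarrow> ('a \<Rightarrow> 'a) \<Rightarrow> 'a set \<Rightarrow> bool" where
  "minimal_set X f M \<longleftrightarrow>
     M \<noteq> {} \<and> closedin X M \<and> f ` M \<subseteq> M \<and>
     (\<forall>N. N \<subseteq> M \<and> N \<noteq> {} \<and> closedin X N \<and> f ` N \<subseteq> N \<longrightarrow> N = M)"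

definition invariant_prob :: "'a topology \<Rightarrow> ('a \<Rightarrow> 'a) \<Rightarrow> 'a measure \<Rightarrow> bool" where
  "invariant_prob X f \<mu> \<longleftrightarrow>
     prob_space \<mu> \<and> space \<mu> = topspace X \<and>
     sets \<mu> = sigma_sets (topspace X) {U. openin X U} \<and>
     f \<in> measurable \<mu> \<mu> \<and> distr \<mu> \<mu> f = \<mu>"

definition weakly_mixing :: "'a measure \<Rightarrow> ('a \<Rightarrow> 'a) \<Rightarrow> bool" where
  "weakly_mixing \<mu> f \<longleftrightarrow>
     (\<forall>A\<in>sets \<mu>. \<forall>B\<in>sets \<mu>.
        (\<lambda>n. (\<Sum>k<n. \<bar>measure \<mu> ((f ^^ k) -` A \<inter> B) - measure \<mu> A * measure \<mu> B\<bar>) / real n)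
          \<longlonglongrightarrow> 0)"

text \<open>Open rays are taken with endpoints in \<open>S\<close> only, so this is the intrinsic order topology
  of \<open>S\<close>; it can be strictly coarser than the subspace topology inherited from the whole type.\<close>

definition order_topology_on :: "'a::linorder set \<Rightarrow> 'a topology" where
  "order_topology_on S =
     topology_generated_by
       ({S} \<union> {{x \<in> S. x < a} |a. a \<in> S} \<union> {{x \<in> S. a < x} |a. a \<in> S})"

definition cantor_topology :: "(nat \<Rightarrow> bool) topology" where
  "cantor_topology = product_topology (\<lambda>_. discrete_topology UNIV) UNIV"

text \<open>Addition of 1 with carry: digit \<open>n\<close> changes iff all lower digits are 1.\<close>

definition dyadic_odometer :: "(nat \<Rightarrow> bool) \<Rightarrow> (nat \<Rightarrow> bool)" where
  "dyadic_odometer x = (\<lambda>n. if (\<forall>k<n. x k) then \<not> x n else x n)"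

abbreviation unit_I :: "real set" where
  "unit_I \<equiv> {0..<1}"

definition von_neumann_kakutani :: "real \<Rightarrow> real" where
  "von_neumann_kakutani x =
     (let n = (THE n::nat. n \<ge> 1 \<and> x \<in> {1 - 1 / 2 ^ (n - 1) ..< 1 - 1 / 2 ^ n})
      in x - (1 - 3 / 2 ^ n))"

definition rot :: "nat \<Rightarrow> (nat \<Rightarrow> nat) \<Rightarrow> real \<Rightarrow> real" where
  "rot q \<pi> x = (let i = nat \<lfloor>real q * x\<rfloor> in x + (real (\<pi> i) - real i) / real q)"

definition rotated_odometer :: "nat \<Rightarrow> (nat \<Rightarrow> nat) \<Rightarrow> real \<Rightarrow> real" where
  "rotated_odometer q \<pi> = von_neumann_kakutani \<circ> rot q \<pi>"

definition I_per :: "nat \<Rightarrow> (nat \<Rightarrow> nat) \<Rightarrow> real set" where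
  "I_per q \<pi> = {x \<in> unit_I. \<exists>n\<ge>1. (rotated_odometer q \<pi> ^^ n) x = x}"

definition D0 :: "nat \<Rightarrow> (nat \<Rightarrow> nat) \<Rightarrow> real set" where
  "D0 q \<pi> =
     {0} \<union> {x \<in> unit_I. \<exists>n::nat. rot q \<pi> x = 1 - 1 / 2 ^ n}
         \<union> {x \<in> unit_I. \<not> continuous (at x within unit_I) (rotated_odometer q \<pi>)}"

definition D :: "nat \<Rightarrow> (nat \<Rightarrow> nat) \<Rightarrow> real set" where
  "D q \<pi> =
     {(rotated_odometer q \<pi> ^^ n) x |n x. x \<in> D0 q \<pi>}
     \<union> {y \<in> unit_I. \<exists>n. (rotated_odometer q \<pi> ^^ n) y \<in> D0 q \<pi> - {0}}"

text \<open>\<open>Minus x\<close> is the added point \<open>x\<^sup>-\<close>, and \<open>Plus x\<close> is the point \<open>x = x\<^sup>+\<close> of the half-open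
  interval. The endpoint \<open>1 = 1\<^sup>-\<close> is \<open>Minus 1\<close>.\<close>

datatype split_point = Minus (base: real) | Plus (base: real)

instantiation split_point :: linorder
begin

definition less_split_point :: "split_point \<Rightarrow> split_point \<Rightarrow> bool" where
  "p < r \<longleftrightarrow> base p < base r \<or> (\<exists>x. p = Minus x \<and> r = Plus x)"

definition less_eq_split_point :: "split_point \<Rightarrow> split_point \<Rightarrow> bool" where
  "p \<le> r \<longleftrightarrow> p = r \<or> p < (r :: split_point)"

instance
proof
  fix p r s :: split_point
  show "(p < r) = (p \<le> r \<and> \<not> r \<le> p)"
    by (cases p; cases r) (auto simp: less_eq_split_point_def less_split_point_def)
  show "p \<le> p"
    by (simp add: less_eq_split_point_def)
  show "p \<le> s" if "p \<le> r" "r \<le> s"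
    using that by (cases p; cases r; cases s)
      (auto simp: less_eq_split_point_def less_split_point_def)
  show "p = r" if "p \<le> r" "r \<le> p"
    using that by (cases p; cases r) (auto simp: less_eq_split_point_def less_split_point_def)
  show "p \<le> r \<or> r \<le> p"
    by (cases p; cases r) (auto simp: less_eq_split_point_def less_split_point_def)
qed

end

definition I_star :: "nat \<Rightarrow> (nat \<Rightarrow> nat) \<Rightarrow> split_point set" where
  "I_star q \<pi> = Plus ` unit_I \<union> Minus ` (D q \<pi> - {0}) \<union> {Minus 1}"

definition top_star :: "nat \<Rightarrow> (nat \<Rightarrow> nat) \<Rightarrow> split_point topology" where
  "top_star q \<pi> = order_topology_on (I_star q \<pi>)"

definition x_hat :: "nat \<Rightarrow> (nat \<Rightarrow> nat) \<Rightarrow> real" where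
  "x_hat q \<pi> = Lim (at_left 1) (the_inv_into unit_I (rot q \<pi>))"

definition F_star :: "nat \<Rightarrow> (nat \<Rightarrow> nat) \<Rightarrow> split_point \<Rightarrow> split_point" where
  "F_star q \<pi> p =
     (case p of
        Plus x \<Rightarrow> Plus (rotated_odometer q \<pi> x)
      | Minus z \<Rightarrow>
          if z = x_hat q \<pi> then Plus 0
          else (THE l. limitin (top_star q \<pi>) (\<lambda>y. Plus (rotated_odometer q \<pi> y)) l (at_left z)))"

definition I_per_star :: "nat \<Rightarrow> (nat \<Rightarrow> nat) \<Rightarrow> split_point set" where
  "I_per_star q \<pi> =
     \<Union> {I_star q \<pi> \<inter> {Plus x..Minus y} |x y.
          x \<in> D q \<pi> \<and> y \<in> D q \<pi> \<union> {1} \<and> x < y \<and> {x..<y} \<subseteq> I_per q \<pi>}"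

definition I_np_star :: "nat \<Rightarrow> (nat \<Rightarrow> nat) \<Rightarrow> split_point set" where
  "I_np_star q \<pi> = I_star q \<pi> - I_per_star q \<pi>"

definition I_min_star :: "nat \<Rightarrow> (nat \<Rightarrow> nat) \<Rightarrow> split_point set" where
  "I_min_star q \<pi> =
     (THE M. minimal_set (subtopology (top_star q \<pi>) (I_np_star q \<pi>)) (F_star q \<pi>) M)"

definition top_min :: "nat \<Rightarrow> (nat \<Rightarrow> nat) \<Rightarrow> split_point topology" where
  "top_min q \<pi> = subtopology (top_star q \<pi>) (I_min_star q \<pi>)"

definition mu_min :: "nat \<Rightarrow> (nat \<Rightarrow> nat) \<Rightarrow> split_point measure" where
  "mu_min q \<pi> = (THE \<mu>. invariant_prob (top_min q \<pi>) (F_star q \<pi>) \<mu>)"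

end

theory Submission
  imports Defs
begin

text \<open>Write \<open>a\<close> for the von Neumann-Kakutani map and \<open>F = a \<circ> R\<^sub>\<pi>\<close>. Both families are built from maps all of whose
orbits visit every interval within a uniformly bounded time. For such a map there are no periodic
points, so nothing is removed from the compactification, and every orbit of the extended map is
dense as well: an added point \<open>z\<^sup>-\<close> either moves into \<open>I\<close> or its first \<open>N\<close> iterates follow those of a
real point slightly to the left of \<open>z\<close>. Hence the minimal set is all of \<open>I\<^sup>*\<close> (\<open>I_min_star_eq\<close>).

For the first family take \<open>\<pi> = id\<close>, so that \<open>F = a\<close>. In binary digits, read from the most significant
one, \<open>a\<close> is addition of 1 with carry. The forward orbit of \<open>0\<close> consists of all dyadic rationals, so
all of them are split in \<open>I\<^sup>*\<close> and the digits become continuous: \<open>x\<^sup>+\<close> gets the terminating expansion of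
a dyadic \<open>x\<close>, and \<open>x\<^sup>-\<close> the one that ends in ones. The digit map is the factor
(\<open>factor_onto_dyadic_odometer\<close>).

For the second family take \<open>q = 4r\<close> with \<open>r \<ge> 3\<close> odd and let \<open>\<pi>\<close> be the 3-cycle
\<open>2r \<rightarrow> 3r \<rightarrow> 4r-1 \<rightarrow> 2r\<close>. Without \<open>\<pi>\<close> the map is a tower of height 4 over \<open>[0, 1/4)\<close>, on which
the return map is a copy of \<open>a\<close>. The 3-cycle removes the two upper floors above the first of the \<open>r\<close>
columns and puts them on top of the last column. The return map stays the same, but the return
time is now 2 on the first column, 6 on the last one and 4 elsewhere. Three consequences follow.

\<^item> All return times are even, and indeed \<open>F\<close> exchanges \<open>[0, 1/2)\<close> and \<open>[1/2, 1)\<close>; this excludes weak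
  mixing (\<open>not_weakly_mixing_if_swaps_halves\<close>).

\<^item> Let \<open>2\<^sup>k\<close> returns start at \<open>0\<close>. They visit the points \<open>j / 2\<^sup>k\<close> of the base (rescaled to unit
  length), and as \<open>r\<close> does not divide \<open>2\<^sup>k\<close>, the first column is visited exactly once more than the
  last one. The total time is therefore \<open>4 \<cdot> 2\<^sup>k - 2\<close> (\<open>sum_roof\<close>), while the end point tends to \<open>0\<close>. A factor
  map to the dyadic odometer would see addition of \<open>2\<close> modulo \<open>4\<close> along times at which the orbit
  comes back to its start, which contradicts continuity (\<open>no_dyadic_factor\<close>).

\<^item> An invariant measure of the extended map has no atoms, so it lives on \<open>I\<close>. There the odometer in the
  base forces equal mass on dyadic intervals of equal length, and the floors are translates of the
  base, so the measure is Lebesgue measure (\<open>\<nu>_eq_uniform\<close>, \<open>mu_min_eq\<close>). This identifies the measure in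
  the definition of weak mixing.\<close>

section \<open>The von Neumann-Kakutani odometer\<close>

abbreviation odo :: "real \<Rightarrow> real" where
  "odo \<equiv> von_neumann_kakutani"

text \<open>The intervals \<open>[1 - 2\<^sup>1\<^sup>-\<^sup>n, 1 - 2\<^sup>-\<^sup>n)\<close> tile
\<open>[0, 1)\<close>; \<open>n\<close> is the least index whose right end point exceeds
\<open>x\<close>.\<close>

lemma unit_I_cell:
  assumes "x \<in> unit_I"
  obtains n :: nat where "n \<ge> 1" "1 - 1 / 2 ^ (n - 1) \<le> x" "x < 1 - 1 / 2 ^ n"
proof -
  define n where "n = (LEAST n::nat. x < 1 - 1 / 2 ^ n)"
  obtain m where "(1/2::real) ^ m < 1 - x"
    using real_arch_pow_inv[of "1 - x" "1/2"] assms by auto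
  hence m: "x < 1 - 1 / 2 ^ m" by (simp add: power_one_over)
  hence n: "x < 1 - 1 / 2 ^ n" unfolding n_def by (rule LeastI)
  hence "n \<ge> 1" using assms by (cases n) auto
  moreover have "\<not> x < 1 - 1 / 2 ^ (n - 1)"
    using not_less_Least[of "n - 1" "\<lambda>n. x < 1 - 1 / 2 ^ n"] \<open>n \<ge> 1\<close> unfolding n_def by simp
  ultimately show ?thesis using that n by simp
qed

lemma odometer_on_cell:
  assumes "n \<ge> 1" "1 - 1 / 2 ^ (n - 1) \<le> x" "x < 1 - 1 / 2 ^ n"
  shows "odo x = x - (1 - 3 / 2 ^ n)"
proof -
  have sep: False if "i < j" "x < 1 - 1 / 2 ^ i" "1 - 1 / 2 ^ (j - 1) \<le> x" for i j :: nat
  proof -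
    have "(1::real) / 2 ^ (j - 1) \<le> 1 / 2 ^ i"
      using that(1) by (intro divide_left_mono power_increasing) auto
    thus False using that by linarith
  qed
  have "(THE n::nat. n \<ge> 1 \<and> x \<in> {1 - 1 / 2 ^ (n - 1) ..< 1 - 1 / 2 ^ n}) = n"
  proof (rule the_equality)
    show "m = n" if "m \<ge> 1 \<and> x \<in> {1 - 1 / 2 ^ (m - 1) ..< 1 - 1 / 2 ^ m}" for m
      using sep[of m n] sep[of n m] that assms by (metis atLeastLessThan_iff linorder_neqE_nat)
  qed (use assms in auto)
  thus ?thesis unfolding von_neumann_kakutani_def Let_def by simp
qed

lemma odometer_low: "0 \<le> x \<Longrightarrow> x < 1/2 \<Longrightarrow> odo x = x + 1/2"
  using odometer_on_cell[of 1 x] by simp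

text \<open>Together with \<open>odometer_low\<close> this is the self-similarity of \<open>a\<close>: the
right half is sent to the left half by a copy of \<open>a\<close> at half scale. All facts about iterates of
\<open>a\<close> below come from it by induction on the dyadic level.\<close>

lemma odometer_high:
  assumes "y \<in> unit_I"
  shows "odo ((1 + y) / 2) = odo y / 2"
proof -
  obtain n where n: "n \<ge> 1" "1 - 1 / 2 ^ (n - 1) \<le> y" "y < 1 - 1 / 2 ^ n"
    using unit_I_cell[OF assms] .
  then obtain m where m: "n = Suc m" by (cases n) auto
  have "odo ((1 + y) / 2) = (1 + y) / 2 - (1 - 3 / 2 ^ Suc n)"
    by (rule odometer_on_cell) (use n m in \<open>auto simp: field_simps\<close>)
  also have "\<dots> = (y - (1 - 3 / 2 ^ n)) / 2" by (simp add: diff_divide_distrib add_divide_distrib)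
  finally show ?thesis using odometer_on_cell[OF n] by simp
qed

lemma odometer_high': "1/2 \<le> x \<Longrightarrow> x < 1 \<Longrightarrow> odo x = odo (2 * x - 1) / 2"
  using odometer_high[of "2 * x - 1"] by simp

lemma odometer_range:
  assumes "n \<ge> 1" "1 - 1 / 2 ^ (n - 1) \<le> x" "x < 1 - 1 / 2 ^ n"
  shows "1 / 2 ^ n \<le> odo x" "odo x < 1 / 2 ^ (n - 1)"
proof -
  have "(1::real) / 2 ^ (n - 1) = 2 / 2 ^ n" using assms(1) by (cases n) auto
  thus "1 / 2 ^ n \<le> odo x" "odo x < 1 / 2 ^ (n - 1)"
    using assms(2,3) unfolding odometer_on_cell[OF assms] by simp_all
qed

lemma odometer_unit_I:
  assumes "x \<in> unit_I" shows "odo x \<in> unit_I"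
proof -
  obtain n where n: "n \<ge> 1" "1 - 1 / 2 ^ (n - 1) \<le> x" "x < 1 - 1 / 2 ^ n"
    using unit_I_cell[OF assms] .
  have "(1::real) / 2 ^ (n - 1) \<le> 1" by simp
  moreover have "(0::real) < 1 / 2 ^ n" by simp
  ultimately show ?thesis using odometer_range[OF n] unfolding atLeastLessThan_iff by linarith
qed

lemma inj_on_odometer: "inj_on odo unit_I"
proof (rule inj_onI)
  fix x y assume x: "x \<in> unit_I" and y: "y \<in> unit_I"
    and eq: "odo x = odo y"
  obtain n where n: "n \<ge> 1" "1 - 1 / 2 ^ (n - 1) \<le> x" "x < 1 - 1 / 2 ^ n"
    using unit_I_cell[OF x] .
  obtain m where m: "m \<ge> 1" "1 - 1 / 2 ^ (m - 1) \<le> y" "y < 1 - 1 / 2 ^ m"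
    using unit_I_cell[OF y] .
  have sep: False if "i < j" "1 / 2 ^ i \<le> w" "w < 1 / 2 ^ (j - 1)" for i j :: nat and w :: real
  proof -
    have "(1::real) / 2 ^ (j - 1) \<le> 1 / 2 ^ i"
      using that(1) by (intro divide_left_mono power_increasing) auto
    thus False using that by linarith
  qed
  have "n = m"
    using sep[OF _ odometer_range(1)[OF n] odometer_range(2)[OF m, folded eq]]
      sep[OF _ odometer_range(1)[OF m, folded eq] odometer_range(2)[OF n]]
    by (metis linorder_cases)
  hence "x - (1 - 3 / 2 ^ m) = y - (1 - 3 / 2 ^ m)"
    using odometer_on_cell[OF n] odometer_on_cell[OF m] eq by metis
  thus "x = y" by linarith
qed

lemma funpow_odometer_unit_I:
  "x \<in> unit_I \<Longrightarrow> (odo ^^ n) x \<in> unit_I"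
proof (induction n)
  case (Suc n)
  then show ?case unfolding funpow.simps comp_apply by (intro odometer_unit_I) simp
qed simp

text \<open>The first return map to \<open>[0, 1/2)\<close> is \<open>a\<^sup>2\<close>, and it is again
\<open>a\<close> at half scale.\<close>

lemma funpow_odometer_double:
  assumes "y \<in> unit_I"
  shows "(odo ^^ (2 * n)) (y / 2) = (odo ^^ n) y / 2"
proof (induction n)
  case (Suc n)
  define u where "u = (odo ^^ n) y"
  have u: "u \<in> unit_I" unfolding u_def by (rule funpow_odometer_unit_I[OF assms])
  have "(odo ^^ (2 * Suc n)) (y / 2) = odo (odo ((odo ^^ (2 * n)) (y / 2)))" by simp
  also have "\<dots> = odo (odo (u / 2))" unfolding Suc u_def ..
  also have "odo (u / 2) = (1 + u) / 2"
    using odometer_low[of "u/2"] u by (simp add: add_divide_distrib)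
  finally have "(odo ^^ (2 * Suc n)) (y / 2) = odo u / 2"
    using odometer_high[OF u] by simp
  thus ?case by (simp add: u_def)
qed simp

lemma funpow_odometer_double_Suc:
  assumes "y \<in> unit_I"
  shows "(odo ^^ (2 * n + 1)) (y / 2) = (odo ^^ n) y / 2 + 1/2"
proof -
  have "(odo ^^ (2 * n + 1)) (y / 2)
      = odo ((odo ^^ n) y / 2)"
    by (simp add: funpow_odometer_double[OF assms] del: funpow_mult)
  also have "\<dots> = (odo ^^ n) y / 2 + 1/2"
    using funpow_odometer_unit_I[OF assms, of n] by (intro odometer_low) auto
  finally show ?thesis .
qed

lemma odometer_renormalise:
  "y \<in> unit_I \<Longrightarrow> (odo ^^ (2 ^ k)) (y / 2 ^ k) = odo y / 2 ^ k"
proof (induction k)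
  case (Suc k)
  have "y / 2 ^ k \<in> unit_I"
    using Suc.prems by (auto simp: divide_less_eq intro: less_le_trans[of y 1])
  from funpow_odometer_double[OF this, of "2 ^ k"] Suc show ?case by (simp add: mult.commute)
qed simp

text \<open>The \<open>2\<^sup>k\<close> dyadic intervals of level \<open>k\<close> form a tower over
\<open>[0, 2\<^sup>-\<^sup>k)\<close>: even times come from the tower of level \<open>k-1\<close> in the left
half, odd times from its translate in the right half.\<close>

lemma odometer_reaches_dyadic_cell:
  fixes j :: nat
  shows "j < 2 ^ k \<Longrightarrow> \<exists>n < 2 ^ k. \<forall>s\<in>{0..<1 / 2 ^ k}. (odo ^^ n) s = j / 2 ^ k + s"
proof (induction k arbitrary: j)
  case (Suc k)
  define i where "i = (if j < 2 ^ k then j else j - 2 ^ k)"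
  have "i < 2 ^ k" using Suc.prems by (auto simp: i_def)
  then obtain n where n: "n < 2 ^ k"
    "\<And>s. s \<in> {0..<1 / 2 ^ k} \<Longrightarrow> (odo ^^ n) s = i / 2 ^ k + s"
    using Suc.IH by blast
  have s: "2 * s \<in> {0..<1 / 2 ^ k}" "2 * s \<in> unit_I" if "s \<in> {0..<1 / 2 ^ Suc k}" for s :: real
  proof -
    have "(1::real) / 2 ^ k \<le> 1" by simp
    moreover show "2 * s \<in> {0..<1 / 2 ^ k}" using that by (auto simp: field_simps)
    ultimately show "2 * s \<in> unit_I" using less_le_trans[of "2 * s" "1 / 2 ^ k" 1] by auto
  qed
  have half: "2 * s / 2 = s" for s :: real by simp
  show ?case
  proof (cases "j < 2 ^ k")
    case True
    have "(odo ^^ (2 * n)) s = j / 2 ^ Suc k + s" if "s \<in> {0..<1 / 2 ^ Suc k}" for s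
    proof -
      have "(odo ^^ (2 * n)) s = (i / 2 ^ k + 2 * s) / 2"
        by (rule funpow_odometer_double[OF s(2)[OF that], of n, unfolded n(2)[OF s(1)[OF that]] half])
      thus ?thesis using True by (simp add: i_def add_divide_distrib)
    qed
    thus ?thesis using n(1) by (intro exI[of _ "2 * n"]) auto
  next
    case False
    have "(odo ^^ (2 * n + 1)) s = j / 2 ^ Suc k + s"
      if "s \<in> {0..<1 / 2 ^ Suc k}" for s
    proof -
      have "(odo ^^ (2 * n + 1)) s = (i / 2 ^ k + 2 * s) / 2 + 1/2"
        by (rule funpow_odometer_double_Suc[OF s(2)[OF that], of n, unfolded n(2)[OF s(1)[OF that]] half])
      thus ?thesis using False by (simp add: i_def of_nat_diff add_divide_distrib diff_divide_distrib)
    qed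
    thus ?thesis using n(1) by (intro exI[of _ "2 * n + 1"]) auto
  qed
qed simp

lemma dyadic_cell_of:
  assumes "x \<in> unit_I"
  obtains j :: nat and s where "j < 2 ^ k" "s \<in> {0..<1 / 2 ^ k}" "x = j / 2 ^ k + s"
proof -
  define j where "j = nat \<lfloor>x * 2 ^ k\<rfloor>"
  have j: "real j \<le> x * 2 ^ k" "x * 2 ^ k < real j + 1"
    using assms by (auto simp: j_def)
  have "x * 2 ^ k < 1 * 2 ^ k" using assms by (intro mult_strict_right_mono) auto
  hence "real j < 2 ^ k" using j by linarith
  hence "j < 2 ^ k" by (metis of_nat_less_iff of_nat_numeral of_nat_power)
  moreover have "x - j / 2 ^ k = (x * 2 ^ k - real j) / 2 ^ k" by (simp add: field_simps)
  hence "x - j / 2 ^ k \<in> {0..<1 / 2 ^ k}" using j by (auto simp: divide_strict_right_mono)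
  ultimately show ?thesis using that[of j "x - j / 2 ^ k"] by simp
qed

text \<open>One passage through the tower of level \<open>k\<close> returns to its bottom, and a second one
climbs to the prescribed floor; this bounds the waiting time independently of \<open>x\<close>.\<close>

lemma odometer_visits_dyadic_cell:
  fixes j :: nat
  assumes x: "x \<in> unit_I" and j: "j < 2 ^ k"
  shows "\<exists>n \<le> 2 * 2 ^ k. (odo ^^ n) x \<in> {j / 2 ^ k ..< (j + 1) / 2 ^ k}"
proof -
  obtain i :: nat and s where x_eq: "i < 2 ^ k" "s \<in> {0..<1 / 2 ^ k}" "x = i / 2 ^ k + s"
    using dyadic_cell_of[OF x, of k] .
  obtain m where m: "m < 2 ^ k" "(odo ^^ m) s = x"
    using odometer_reaches_dyadic_cell[OF x_eq(1)] x_eq by metis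
  obtain n where n: "n < 2 ^ k"
    "\<And>s. s \<in> {0..<1 / 2 ^ k} \<Longrightarrow> (odo ^^ n) s = j / 2 ^ k + s"
    using odometer_reaches_dyadic_cell[OF j] by blast
  define t where "t = odo (2 ^ k * s) / 2 ^ k"
  have u: "2 ^ k * s \<in> unit_I" using x_eq(2) by (auto simp: field_simps)
  have t: "t \<in> {0..<1 / 2 ^ k}"
    using odometer_unit_I[OF u] by (auto simp: t_def divide_strict_right_mono)
  have "(odo ^^ (2 ^ k - m)) x = (odo ^^ (2 ^ k)) s"
    using m(1) funpow_add[of "2 ^ k - m" m odo] by (simp add: m(2)[symmetric])
  also have "\<dots> = t" using odometer_renormalise[OF u, of k] by (simp add: t_def)
  finally have "(odo ^^ (n + (2 ^ k - m))) x = j / 2 ^ k + t"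
    using n(2)[OF t] by (simp add: funpow_add)
  moreover have "n + (2 ^ k - m) \<le> 2 * 2 ^ k" using n(1) by linarith
  ultimately show ?thesis using t by (intro exI[of _ "n + (2 ^ k - m)"]) (auto simp: add_divide_distrib)
qed

lemma dyadic_cell_in_interval:
  fixes u v :: real
  assumes "0 \<le> u" "u < v" "v \<le> 1"
  obtains k j :: nat where "j < 2 ^ k" "u < j / 2 ^ k" "(j + 1) / 2 ^ k < v"
proof -
  obtain k where "(1/2::real) ^ k < (v - u) / 3"
    using real_arch_pow_inv[of "(v - u) / 3" "1/2"] assms by auto
  hence k: "1 / 2 ^ k < (v - u) / 3" by (simp add: power_one_over)
  define j where "j = nat \<lfloor>u * 2 ^ k\<rfloor> + 1"
  have "0 \<le> u * 2 ^ k" using assms by simp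
  hence j: "u * 2 ^ k < real j" "real j \<le> u * 2 ^ k + 1" unfolding j_def by linarith+
  have "1 < (v - u) / 3 * 2 ^ k" using k by (simp add: divide_less_eq)
  hence *: "real j + 1 < v * 2 ^ k" using j by (simp add: algebra_simps)
  moreover have "v * 2 ^ k \<le> 1 * 2 ^ k" using assms by (intro mult_right_mono) auto
  ultimately have "real j < 2 ^ k" by linarith
  hence "j < 2 ^ k" by (metis of_nat_less_iff of_nat_numeral of_nat_power)
  thus ?thesis using that[of j k] j * by (simp add: field_simps)
qed

text \<open>The first \<open>2\<^sup>k\<close> points of the orbit of \<open>0\<close> (the van der Corput
sequence) are a rearrangement of the dyadic rationals \<open>j / 2\<^sup>k\<close>.\<close>

lemma sum_odometer_orbit:
  fixes f :: "real \<Rightarrow> real"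
  shows "(\<Sum>n<2 ^ k. f ((odo ^^ n) 0)) = (\<Sum>j<2 ^ k. f (real j / 2 ^ k))"
proof (induction k arbitrary: f)
  case (Suc k)
  have even: "(odo ^^ (2 * n)) 0 = (odo ^^ n) 0 / 2"
    and odd: "(odo ^^ (2 * n + 1)) 0 = (odo ^^ n) 0 / 2 + 1/2" for n
    using funpow_odometer_double[of 0 n] funpow_odometer_double_Suc[of 0 n] unfolding div_0 by auto
  have split: "(\<Sum>n<2 * m. g n) = (\<Sum>n<m. g (2 * n) + g (2 * n + 1))" for g :: "nat \<Rightarrow> real" and m
    by (induction m) auto
  have halves: "(\<Sum>n<2 * m. g n) = (\<Sum>n<m. g n + g (m + n))" for g :: "nat \<Rightarrow> real" and m
  proof -
    have "(\<Sum>n<m + i. g n) = (\<Sum>n<m. g n) + (\<Sum>n<i. g (m + n))" for i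
      by (induction i) (auto simp: add.assoc)
    thus ?thesis by (simp add: mult_2 sum.distrib)
  qed
  have *: "real j / 2 ^ k / 2 = real j / 2 ^ Suc k"
    "real j / 2 ^ Suc k + 1/2 = real (2 ^ k + j) / 2 ^ Suc k" for j
    by (simp_all add: add_divide_distrib)
  have "(\<Sum>n<2 ^ Suc k. f ((odo ^^ n) 0))
      = (\<Sum>n<2 ^ k. f ((odo ^^ n) 0 / 2) + f ((odo ^^ n) 0 / 2 + 1/2))"
    unfolding power_Suc split even odd ..
  also have "\<dots> = (\<Sum>j<2 ^ k. f (real j / 2 ^ Suc k) + f (real (2 ^ k + j) / 2 ^ Suc k))"
    using Suc[of "\<lambda>x. f (x / 2) + f (x / 2 + 1/2)"] unfolding * .
  also have "\<dots> = (\<Sum>j<2 ^ Suc k. f (real j / 2 ^ Suc k))"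
    unfolding power_Suc halves by (rule refl)
  finally show ?case .
qed simp

section \<open>Rotated odometers on the interval\<close>

text \<open>If \<open>x < y\<close> are both left over, then \<open>y\<close> lies beyond the interval to the
right of \<open>x\<close>. The intervals at the leftover points are thus disjoint, and each of them contains a
rational.\<close>

lemma countable_not_right_covered:
  fixes S :: "real set"
  assumes "\<And>x. x \<in> S \<Longrightarrow> 0 < e x"
  shows "countable (S - (\<Union>x\<in>S. {x<..<x + e x}))"
proof -
  define T where "T = S - (\<Union>x\<in>S. {x<..<x + e x})"
  have "\<forall>x\<in>T. \<exists>s\<in>\<rat>. x < s \<and> s < x + e x"
    using assms by (auto simp: T_def intro!: Rats_dense_in_real)
  then obtain s where s: "\<And>x. x \<in> T \<Longrightarrow> s x \<in> \<rat> \<and> x < s x \<and> s x < x + e x"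
    by metis
  have less: "s x < s y" if "x \<in> T" "y \<in> T" "x < y" for x y
  proof -
    have "x + e x \<le> y" using that by (fastforce simp: T_def)
    thus ?thesis using s[OF that(1)] s[OF that(2)] by linarith
  qed
  have "inj_on s T"
    by (rule inj_onI) (metis less less_irrefl linorder_neqE_linordered_idom)
  moreover have "countable (s ` T)"
    by (rule countable_subset[OF _ countable_rat]) (use s in auto)
  ultimately show ?thesis
    unfolding T_def[symmetric] by (metis countable_image_inj_on)
qed

locale rotated =
  fixes q :: nat and \<pi> :: "nat \<Rightarrow> nat"
  assumes perm: "\<pi> permutes {..<q}" and q_pos: "0 < q"
begin

abbreviation R :: "real \<Rightarrow> real" where "R \<equiv> rot q \<pi>"
abbreviation F :: "real \<Rightarrow> real" where "F \<equiv> rotated_odometer q \<pi>"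

lemma perm_less: "i < q \<Longrightarrow> \<pi> i < q"
  using permutes_in_image[OF perm, of i] by simp

lemma letter_of:
  assumes "x \<in> unit_I"
  obtains i where "i < q" "real i / q \<le> x" "x < (real i + 1) / q"
proof -
  define i where "i = nat \<lfloor>q * x\<rfloor>"
  have i: "real i \<le> q * x" "q * x < real i + 1" using assms by (auto simp: i_def)
  have "q * x < real q * 1" using assms q_pos by (intro mult_strict_left_mono) auto
  hence "i < q" using i by linarith
  thus ?thesis using that[of i] i q_pos by (simp add: field_simps)
qed

lemma rot_on_letter:
  assumes "real i / q \<le> x" "x < (real i + 1) / q"
  shows "R x = x + (real (\<pi> i) - real i) / q"
proof -
  have "\<lfloor>q * x\<rfloor> = int i"
    by (rule floor_unique) (use assms q_pos in \<open>auto simp: field_simps\<close>)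
  thus ?thesis by (simp add: rot_def)
qed

lemma rot_letter_image:
  assumes "real i / q \<le> x" "x < (real i + 1) / q"
  shows "real (\<pi> i) / q \<le> R x" "R x < (real (\<pi> i) + 1) / q"
  using assms unfolding rot_on_letter[OF assms] add_divide_distrib diff_divide_distrib by linarith+

lemma letter_unique:
  assumes "real i / q \<le> x" "x < (real i + 1) / q" "real j / q \<le> x" "x < (real j + 1) / q"
  shows "i = j"
proof -
  have "real i < real j + 1" "real j < real i + 1"
    using assms q_pos by (auto simp: field_simps intro: le_less_trans)
  thus ?thesis by linarith
qed

lemma letter_le_1: "i < q \<Longrightarrow> (real i + 1) / q \<le> 1"
  using q_pos by (simp add: field_simps)

lemma rot_unit_I: "x \<in> unit_I \<Longrightarrow> R x \<in> unit_I"
proof -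
  assume x: "x \<in> unit_I"
  obtain i where i: "i < q" "real i / q \<le> x" "x < (real i + 1) / q" using letter_of[OF x] .
  have "0 \<le> real (\<pi> i) / q" by simp
  then show ?thesis using rot_letter_image[OF i(2,3)] letter_le_1[OF perm_less[OF i(1)]]
    unfolding atLeastLessThan_iff by linarith
qed

lemma inj_on_rot: "inj_on R unit_I"
proof (rule inj_onI)
  fix x y assume x: "x \<in> unit_I" and y: "y \<in> unit_I" and eq: "R x = R y"
  obtain i where i: "i < q" "real i / q \<le> x" "x < (real i + 1) / q" using letter_of[OF x] .
  obtain j where j: "j < q" "real j / q \<le> y" "y < (real j + 1) / q" using letter_of[OF y] .
  have "\<pi> i = \<pi> j"
    using rot_letter_image[OF i(2,3)] rot_letter_image[OF j(2,3), folded eq] letter_unique by metis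
  hence "i = j" using permutes_inj[OF perm] by (meson injD)
  hence "x + (real (\<pi> i) - real i) / q = y + (real (\<pi> i) - real i) / q"
    using rot_on_letter[OF i(2,3)] rot_on_letter[OF j(2,3)] eq by metis
  thus "x = y" by linarith
qed

lemma F_unit_I: "x \<in> unit_I \<Longrightarrow> F x \<in> unit_I"
  unfolding rotated_odometer_def comp_apply by (intro odometer_unit_I rot_unit_I)

lemma funpow_F_unit_I: "x \<in> unit_I \<Longrightarrow> (F ^^ n) x \<in> unit_I"
proof (induction n)
  case (Suc n)
  then show ?case unfolding funpow.simps comp_apply by (intro F_unit_I) simp
qed simp

lemma inj_on_F: "inj_on F unit_I"
  unfolding rotated_odometer_def
  by (rule comp_inj_on[OF inj_on_rot inj_on_subset[OF inj_on_odometer]]) (use rot_unit_I in blast)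

lemma inj_on_funpow_F: "inj_on (F ^^ n) unit_I"
proof (induction n)
  case (Suc n)
  have "inj_on (F \<circ> (F ^^ n)) unit_I"
    by (rule comp_inj_on[OF Suc inj_on_subset[OF inj_on_F]]) (use funpow_F_unit_I in blast)
  thus ?case unfolding funpow.simps .
qed simp

text \<open>Both factors of \<open>F\<close> are constant translations on half-open intervals that are closed
on the left.\<close>

lemma F_right_translation:
  assumes "x \<in> unit_I"
  obtains c e where "0 < e" "x + e \<le> 1" "\<And>y. y \<in> {x..<x + e} \<Longrightarrow> F y = y + c"
proof -
  obtain i where i: "i < q" "real i / q \<le> x" "x < (real i + 1) / q" using letter_of[OF assms] .
  define c where "c = (real (\<pi> i) - real i) / q"
  have Rx: "R x = x + c" using rot_on_letter[OF i(2,3)] by (simp add: c_def)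
  obtain n where n: "n \<ge> 1" "1 - 1 / 2 ^ (n - 1) \<le> R x" "R x < 1 - 1 / 2 ^ n"
    using unit_I_cell[OF rot_unit_I[OF assms]] .
  \<comment> \<open>\<open>e\<close> keeps \<open>y\<close> inside its letter and \<open>R y\<close> inside its cell.\<close>
  define e where "e = min ((real i + 1) / q - x) (1 - 1 / 2 ^ n - R x)"
  have e: "0 < e" "x + e \<le> (real i + 1) / q" "R x + e \<le> 1 - 1 / 2 ^ n"
    using i n by (auto simp: e_def)
  show ?thesis
  proof (rule that[of e "c - (1 - 3 / 2 ^ n)"])
    show "x + e \<le> 1" using e letter_le_1[OF i(1)] by linarith
    fix y assume y: "y \<in> {x..<x + e}"
    have "R y = y + c" using rot_on_letter[of i y] i e y by (simp add: c_def)
    moreover have "odo (y + c) = y + c - (1 - 3 / 2 ^ n)"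
      by (rule odometer_on_cell[OF n(1)]) (use n e y Rx in auto)
    ultimately show "F y = y + (c - (1 - 3 / 2 ^ n))" by (simp add: rotated_odometer_def)
  qed (use e in auto)
qed

text \<open>Here \<open>i\<close> is the letter that \<open>\<pi>\<close> sends to the last position. Near
\<open>1\<close> the inverse of \<open>R\<^sub>\<pi>\<close> is a translation, so the limit is the right end
point of the letter \<open>i\<close>.\<close>

lemma x_hat_eq:
  assumes "i < q" "\<pi> i + 1 = q"
  shows "x_hat q \<pi> = (real i + 1) / q"
proof -
  define c where "c = (real (\<pi> i) - real i) / q"
  have inv: "the_inv_into unit_I R y = y - c" if y: "real (\<pi> i) / q < y" "y < 1" for y
  proof (rule the_inv_into_f_eq[OF inj_on_rot])
    have "(real (\<pi> i) + 1) / q = 1" using assms by (simp add: field_simps flip: assms(2))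
    hence "real i / q \<le> y - c" "y - c < (real i + 1) / q"
      using y by (auto simp: c_def add_divide_distrib diff_divide_distrib)
    moreover have "0 \<le> real i / q" by simp
    ultimately show "R (y - c) = y" "y - c \<in> unit_I"
      using rot_on_letter[of i "y - c"] letter_le_1[OF assms(1)]
      unfolding c_def[symmetric] atLeastLessThan_iff by linarith+
  qed
  have "real (\<pi> i) / q < 1" using assms q_pos by (simp add: field_simps)
  hence "\<forall>\<^sub>F y in at_left 1. the_inv_into unit_I R y = y - c"
    unfolding eventually_at_left_field using inv by blast
  moreover have "((\<lambda>y. y - c) \<longlongrightarrow> 1 - c) (at_left 1)" by (intro tendsto_intros)
  ultimately have "(the_inv_into unit_I R \<longlongrightarrow> 1 - c) (at_left 1)"
    using tendsto_cong by force
  hence "x_hat q \<pi> = 1 - c" unfolding x_hat_def by (intro tendsto_Lim) auto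
  also have "1 - c = (real i + 1) / q" using assms(2) q_pos
    by (auto simp: c_def field_simps)
  finally show ?thesis .
qed

text \<open>To the left of \<open>z\<close> the rotation is a translation towards some left limit
\<open>w\<close>. The cells of \<open>a\<close> accumulate only at \<open>1\<close>, so \<open>a\<close> is a
translation to the left of \<open>w\<close> unless \<open>w = 1\<close>, and \<open>w = 1\<close> happens only
for the point \<open>x_hat\<close>.\<close>

lemma F_left_translation:
  assumes z: "0 < z" "z \<le> 1" "z \<noteq> x_hat q \<pi>"
  obtains c e where "0 < e" "e \<le> z" "\<And>y. y \<in> {z - e<..<z} \<Longrightarrow> F y = y + c"
    "0 < z + c" "z + c \<le> 1"
proof -
  obtain i where i: "i < q" "real i / q < z" "z \<le> (real i + 1) / q"
  proof -
    define k where "k = nat \<lceil>q * z\<rceil>"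
    have "0 < q * z" using z q_pos by simp
    hence k: "real k - 1 < q * z" "q * z \<le> real k" "k \<ge> 1"
      unfolding k_def by (auto simp: of_nat_nat) linarith+
    have "q * z \<le> real q * 1" using z by (intro mult_left_mono) auto
    hence "k \<le> q" using k by linarith
    thus ?thesis using that[of "k - 1"] k q_pos by (simp add: field_simps of_nat_diff)
  qed
  define c where "c = (real (\<pi> i) - real i) / q"
  define w where "w = z + c"
  have w: "real (\<pi> i) / q < w" "w \<le> (real (\<pi> i) + 1) / q"
    using i by (auto simp: w_def c_def add_divide_distrib diff_divide_distrib)
  have "w \<noteq> 1"
  proof
    assume "w = 1"
    hence "q \<le> \<pi> i + 1" using w q_pos by (simp add: field_simps)
    hence pi: "\<pi> i + 1 = q" using perm_less[OF i(1)] by simp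
    have "z = (real i + 1) / q" using \<open>w = 1\<close> pi q_pos by (auto simp: w_def c_def field_simps)
    thus False using x_hat_eq[OF i(1) pi] z by simp
  qed
  moreover have "0 \<le> real (\<pi> i) / q" by simp
  ultimately have w01: "0 < w" "w < 1"
    using w letter_le_1[OF perm_less[OF i(1)]] by linarith+
  obtain n where n: "n \<ge> 1" "1 - 1 / 2 ^ (n - 1) < w" "w \<le> 1 - 1 / 2 ^ n"
  proof -
    obtain m where m: "m \<ge> 1" "1 - 1 / 2 ^ (m - 1) \<le> w" "w < 1 - 1 / 2 ^ m"
      using unit_I_cell[of w] w01 by auto
    show ?thesis
    proof (cases "w = 1 - 1 / 2 ^ (m - 1)")
      case True
      hence "m - 1 \<ge> 1" using w01 by (cases "m - 1") auto
      moreover have "(1::real) / 2 ^ (m - 1) < 1 / 2 ^ (m - 1 - 1)"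
        using \<open>m - 1 \<ge> 1\<close> by (intro divide_strict_left_mono power_strict_increasing) auto
      ultimately show ?thesis using that[of "m - 1"] True by simp
    next
      case False
      thus ?thesis using that[of m] m by simp
    qed
  qed
  define e where "e = Min {z - real i / q, w - (1 - 1 / 2 ^ (n - 1)), z}"
  have e: "0 < e" "e \<le> z" "real i / q \<le> z - e" "1 - 1 / 2 ^ (n - 1) \<le> w - e"
  proof -
    have "e \<le> z - real i / q" "e \<le> w - (1 - 1 / 2 ^ (n - 1))" "e \<le> z" by (simp_all add: e_def)
    moreover show "0 < e" using i n z by (simp add: e_def)
    ultimately show "e \<le> z" "real i / q \<le> z - e" "1 - 1 / 2 ^ (n - 1) \<le> w - e" by linarith+
  qed
  define d where "d = c - (1 - 3 / 2 ^ n)"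
  have "w - (1 - 3 / 2 ^ n) \<le> 2 / 2 ^ n" using n by simp
  also have "(2::real) / 2 ^ n \<le> 1" using n(1) by (cases n) auto
  finally have le1: "z + d \<le> 1" by (simp add: w_def d_def)
  have "(1::real) / 2 ^ (n - 1) = 2 / 2 ^ n" using n(1) by (cases n) auto
  moreover have "(0::real) < 1 / 2 ^ n" by simp
  ultimately have gt0: "0 < z + d" using n by (simp add: w_def d_def)
  show ?thesis
  proof (rule that[OF e(1,2) _ gt0 le1])
    fix y assume y: "y \<in> {z - e<..<z}"
    have "R y = y + c" using rot_on_letter[of i y] i e y by (simp add: c_def)
    moreover have "odo (y + c) = y + c - (1 - 3 / 2 ^ n)"
      by (rule odometer_on_cell[OF n(1)]) (use n e y in \<open>auto simp: w_def\<close>)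
    ultimately show "F y = y + d" by (simp add: rotated_odometer_def d_def)
  qed
qed

lemma countable_vimage_funpow_F:
  assumes "countable A" shows "countable {y \<in> unit_I. (F ^^ n) y \<in> A}"
proof -
  have "countable ((F ^^ n) ` {y \<in> unit_I. (F ^^ n) y \<in> A})"
    by (rule countable_subset[OF _ assms]) auto
  moreover have "inj_on (F ^^ n) {y \<in> unit_I. (F ^^ n) y \<in> A}"
    by (rule inj_on_subset[OF inj_on_funpow_F]) auto
  ultimately show ?thesis using countable_image_inj_on by blast
qed

text \<open>By \<open>F_right_translation\<close> the map is continuous at all points in the interior of some
interval of translation, and only countably many points are in no such interior.\<close>

lemma countable_D0: "countable (D0 q \<pi>)"
proof -
  have "\<exists>e. 0 < e \<and> (\<exists>c. \<forall>y\<in>{x..<x + e}. F y = y + c)" if "x \<in> unit_I" for x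
    using F_right_translation[OF that] by metis
  then obtain e where e: "\<And>x. x \<in> unit_I \<Longrightarrow> 0 < e x"
    "\<And>x. x \<in> unit_I \<Longrightarrow> \<exists>c. \<forall>y\<in>{x..<x + e x}. F y = y + c" by metis
  have "continuous (at y within unit_I) F" if x: "x \<in> unit_I" and y: "y \<in> {x<..<x + e x}" for x y
  proof -
    obtain c where c: "\<And>y. y \<in> {x..<x + e x} \<Longrightarrow> F y = y + c" using e(2)[OF x] by blast
    have "continuous_on {x<..<x + e x} F"
      by (subst continuous_on_cong[OF refl, of _ _ "\<lambda>y. y + c"]) (auto intro!: c continuous_intros)
    hence "isCont F y" using y by (simp add: continuous_on_eq_continuous_at)
    thus ?thesis using continuous_at_imp_continuous_at_within by blast
  qed
  hence "{x \<in> unit_I. \<not> continuous (at x within unit_I) F} \<subseteq> unit_I - (\<Union>x\<in>unit_I. {x<..<x + e x})"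
    by blast
  hence 1: "countable {x \<in> unit_I. \<not> continuous (at x within unit_I) F}"
    by (rule countable_subset) (rule countable_not_right_covered[OF e(1)])
  have "countable (R ` {x \<in> unit_I. \<exists>n::nat. R x = 1 - 1 / 2 ^ n})"
    by (rule countable_subset[of _ "range (\<lambda>n::nat. 1 - 1 / 2 ^ n)"]) auto
  moreover have "inj_on R {x \<in> unit_I. \<exists>n::nat. R x = 1 - 1 / 2 ^ n}"
    by (rule inj_on_subset[OF inj_on_rot]) auto
  ultimately have "countable {x \<in> unit_I. \<exists>n::nat. R x = 1 - 1 / 2 ^ n}"
    using countable_image_inj_on by blast
  with 1 show ?thesis by (simp add: D0_def)
qed

lemma countable_D: "countable (D q \<pi>)"
proof -
  have "D q \<pi> = (\<Union>n. (F ^^ n) ` D0 q \<pi>) \<union> (\<Union>n. {y \<in> unit_I. (F ^^ n) y \<in> D0 q \<pi> - {0}})"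
    unfolding D_def by auto
  thus ?thesis using countable_D0 countable_vimage_funpow_F[of "D0 q \<pi> - {0}"] by simp
qed

lemma D_subset: "D q \<pi> \<subseteq> unit_I"
proof -
  have "D0 q \<pi> \<subseteq> unit_I" by (auto simp: D0_def)
  thus ?thesis using funpow_F_unit_I unfolding D_def by blast
qed

end

section \<open>The split interval and the extended map\<close>

lemma topspace_order_topology_on [simp]: "topspace (order_topology_on S) = S"
  by (auto simp: order_topology_on_def topology_generated_by_topspace)

lemma openin_order_topology_on_rays:
  "a \<in> S \<Longrightarrow> openin (order_topology_on S) {x \<in> S. x < a}"
  "a \<in> S \<Longrightarrow> openin (order_topology_on S) {x \<in> S. a < x}"
  unfolding order_topology_on_def by (rule topology_generated_by_Basis; blast)+

lemma Hausdorff_order_topology_on: "Hausdorff_space (order_topology_on S)"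
proof -
  have "\<exists>U V. openin (order_topology_on S) U \<and> openin (order_topology_on S) V \<and> a \<in> U \<and> b \<in> V \<and> disjnt U V"
    if ab: "a \<in> S" "b \<in> S" "a < b" for a b
  proof (cases "\<exists>c\<in>S. a < c \<and> c < b")
    case True
    then obtain c where "c \<in> S" "a < c" "c < b" by blast
    thus ?thesis using ab
      by (intro exI[of _ "{x \<in> S. x < c}"] exI[of _ "{x \<in> S. c < x}"])
        (auto simp: openin_order_topology_on_rays disjnt_def)
  next
    case False
    thus ?thesis using ab
      by (intro exI[of _ "{x \<in> S. x < b}"] exI[of _ "{x \<in> S. a < x}"])
        (auto simp: openin_order_topology_on_rays disjnt_def)
  qed
  thus ?thesis unfolding Hausdorff_space_def topspace_order_topology_on
    by (metis disjnt_sym linorder_neqE)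
qed

context rotated
begin

abbreviation X :: "split_point set" where "X \<equiv> I_star q \<pi>"
abbreviation T :: "split_point topology" where "T \<equiv> top_star q \<pi>"
abbreviation Fs :: "split_point \<Rightarrow> split_point" where "Fs \<equiv> F_star q \<pi>"

lemma topspace_T [simp]: "topspace T = X"
  by (simp add: top_star_def)

lemma Plus_in_X_iff [simp]: "Plus x \<in> X \<longleftrightarrow> x \<in> unit_I"
  by (auto simp: I_star_def)

lemma Minus_in_X_iff: "Minus z \<in> X \<longleftrightarrow> z \<in> D q \<pi> - {0} \<or> z = 1"
  by (auto simp: I_star_def)

lemma Minus_in_X_bounds: "Minus z \<in> X \<Longrightarrow> 0 < z \<and> z \<le> 1"
  using D_subset by (force simp: Minus_in_X_iff)

lemma less_Plus_iff: "p < Plus x \<longleftrightarrow> base p < x \<or> p = Minus x"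
  by (cases p) (auto simp: less_split_point_def)

lemma Minus_less_iff: "Minus x < p \<longleftrightarrow> x < base p \<or> p = Plus x"
  by (cases p) (auto simp: less_split_point_def)

lemma less_Minus_iff: "p < Minus x \<longleftrightarrow> base p < x"
  by (cases p) (auto simp: less_split_point_def)

lemma Plus_less_iff: "Plus x < p \<longleftrightarrow> x < base p"
  by (cases p) (auto simp: less_split_point_def)

lemma openin_T_induct [consumes 1, case_names inter union less greater full]:
  assumes "openin T W"
    and inter: "\<And>U V. P U \<Longrightarrow> P V \<Longrightarrow> P (U \<inter> V)"
    and union: "\<And>\<U>. (\<And>U. U \<in> \<U> \<Longrightarrow> P U) \<Longrightarrow> P (\<Union>\<U>)"
    and less: "\<And>a. a \<in> X \<Longrightarrow> P {r \<in> X. r < a}"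
    and greater: "\<And>a. a \<in> X \<Longrightarrow> P {r \<in> X. a < r}"
    and full: "P X"
  shows "P W"
proof -
  have "generate_topology_on ({X} \<union> {{r \<in> X. r < a} |a. a \<in> X} \<union> {{r \<in> X. a < r} |a. a \<in> X}) W"
    using assms(1) by (simp add: top_star_def order_topology_on_def openin_topology_generated_by_iff)
  thus ?thesis
  proof (induction rule: generate_topology_on.induct)
    case Empty
    show ?case using union[of "{}"] by simp
  qed (use assms(2-) in auto)
qed

text \<open>Near \<open>x\<^sup>+\<close> the order topology looks to the right like the real line, because
nothing except possibly \<open>x\<^sup>-\<close> precedes \<open>x\<^sup>+\<close> immediately.\<close>

lemma right_nbhd:
  assumes "openin T W" "Plus x \<in> W"
  shows "\<exists>e>0. \<forall>r\<in>X. Plus x \<le> r \<and> base r < x + e \<longrightarrow> r \<in> W"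
  using assms
proof (induction rule: openin_T_induct)
  case (inter U V)
  then obtain e d where "0 < e" "\<forall>r\<in>X. Plus x \<le> r \<and> base r < x + e \<longrightarrow> r \<in> U"
    "0 < d" "\<forall>r\<in>X. Plus x \<le> r \<and> base r < x + d \<longrightarrow> r \<in> V" by auto
  thus ?case by (intro exI[of _ "min e d"]) auto
next
  case (union \<U>)
  then obtain U where "U \<in> \<U>" "Plus x \<in> U" by blast
  thus ?case using union.IH[of U] by blast
next
  case (less a)
  hence "0 < base a - x" by (auto simp: Plus_less_iff)
  moreover have "r < a" if "base r < x + (base a - x)" for r
    using that by (cases a; cases r) (auto simp: less_split_point_def)
  ultimately show ?case by blast
next
  case (greater a)
  thus ?case by (intro exI[of _ 1]) auto
next
  case full
  thus ?case by (intro exI[of _ 1]) auto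
qed

text \<open>The analogue on the left needs that \<open>p\<close> is not the upper half of a split pair: either
it is some \<open>w\<^sup>-\<close>, or \<open>w\<close> is not split at all.\<close>

lemma left_nbhd:
  assumes "openin T W" "p \<in> W" "p = Minus w \<or> p = Plus w \<and> Minus w \<notin> X \<and> 0 < w"
  shows "\<exists>e>0. \<forall>r\<in>X. w - e < base r \<and> base r < w \<longrightarrow> r \<in> W"
  using assms(1,2)
proof (induction rule: openin_T_induct)
  case (inter U V)
  then obtain e d where "0 < e" "\<forall>r\<in>X. w - e < base r \<and> base r < w \<longrightarrow> r \<in> U"
    "0 < d" "\<forall>r\<in>X. w - d < base r \<and> base r < w \<longrightarrow> r \<in> V" by auto
  thus ?case by (intro exI[of _ "min e d"]) auto
next
  case (union \<U>)
  then obtain U where "U \<in> \<U>" "p \<in> U" by blast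
  thus ?case using union.IH[of U] by blast
next
  case (less a)
  moreover have "r < a" if "base r < w" for r
    using that less assms(3) by (cases a; cases r) (auto simp: less_split_point_def)
  ultimately show ?case by (intro exI[of _ 1]) auto
next
  case (greater a)
  have "base a < w" using greater assms(3) by (cases a) (auto simp: less_split_point_def)
  moreover have "a < r" if "w - (w - base a) < base r" for r
    using that by (cases a; cases r) (auto simp: less_split_point_def)
  ultimately show ?case by (intro exI[of _ "w - base a"]) auto
next
  case full
  thus ?case by (intro exI[of _ 1]) auto
qed

text \<open>The limit in \<open>I\<^sup>*\<close> of real points that increase to \<open>w\<close>.\<close>

definition left_point :: "real \<Rightarrow> split_point" where
  "left_point w = (if Minus w \<in> X then Minus w else Plus w)"

lemma left_point_in_X: "0 < w \<Longrightarrow> w \<le> 1 \<Longrightarrow> left_point w \<in> X"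
  by (auto simp: left_point_def Minus_in_X_iff)

lemma limitin_left_point:
  assumes "0 < e" "\<And>y. y \<in> {z - e<..<z} \<Longrightarrow> f y = y + c" "0 < z + c" "z + c \<le> 1"
  shows "limitin T (\<lambda>y. Plus (f y)) (left_point (z + c)) (at_left z)"
  unfolding limitin_def topspace_T
proof (intro conjI allI impI)
  show "left_point (z + c) \<in> X" using left_point_in_X assms by simp
  fix U assume U: "openin T U \<and> left_point (z + c) \<in> U"
  have "left_point (z + c) = Minus (z + c) \<or>
      left_point (z + c) = Plus (z + c) \<and> Minus (z + c) \<notin> X \<and> 0 < z + c"
    using assms by (auto simp: left_point_def)
  with U obtain d where d: "0 < d" "\<forall>r\<in>X. z + c - d < base r \<and> base r < z + c \<longrightarrow> r \<in> U"
    using left_nbhd by blast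
  define b where "b = z - Min {e, d, z + c}"
  have b: "b < z" "z - e \<le> b" "z - d \<le> b" "- c \<le> b" using assms d by (auto simp: b_def)
  have "Plus (f y) \<in> U" if y: "b < y" "y < z" for y
  proof -
    have "f y = y + c" using assms(2)[of y] b y by auto
    moreover have "y + c \<in> unit_I" using b y assms by auto
    moreover have "z + c - d < y + c" "y + c < z + c" using b y by auto
    ultimately show ?thesis using d(2) by simp
  qed
  thus "\<forall>\<^sub>F y in at_left z. Plus (f y) \<in> U"
    unfolding eventually_at_left_field using b(1) by blast
qed

lemma F_star_Plus [simp]: "Fs (Plus x) = Plus (F x)"
  by (simp add: F_star_def)

lemma F_star_x_hat [simp]: "Fs (Minus (x_hat q \<pi>)) = Plus 0"
  by (simp add: F_star_def)

lemma F_star_Minus: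
  assumes "z \<noteq> x_hat q \<pi>" "0 < e" "\<And>y. y \<in> {z - e<..<z} \<Longrightarrow> F y = y + c" "0 < z + c" "z + c \<le> 1"
  shows "Fs (Minus z) = left_point (z + c)"
proof -
  have lim: "limitin T (\<lambda>y. Plus (F y)) (left_point (z + c)) (at_left z)"
    by (rule limitin_left_point[OF assms(2-5)])
  have "(THE l. limitin T (\<lambda>y. Plus (F y)) l (at_left z)) = left_point (z + c)"
  proof (rule the_equality, rule lim)
    fix l assume "limitin T (\<lambda>y. Plus (F y)) l (at_left z)"
    thus "l = left_point (z + c)"
      by (intro limitin_Hausdorff_unique[OF _ lim])
        (auto simp: top_star_def Hausdorff_order_topology_on)
  qed
  thus ?thesis using assms(1) by (simp add: F_star_def)
qed

lemma F_star_limit: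
  assumes "Minus z \<in> X" "z \<noteq> x_hat q \<pi>"
  shows "limitin T (\<lambda>y. Plus (F y)) (Fs (Minus z)) (at_left z)"
    and "limitin T Plus (Minus z) (at_left z)"
proof -
  have z: "0 < z" "z \<le> 1" using Minus_in_X_bounds[OF assms(1)] by auto
  obtain c e where ce: "0 < e" "e \<le> z" "\<And>y. y \<in> {z - e<..<z} \<Longrightarrow> F y = y + c"
    "0 < z + c" "z + c \<le> 1" using F_left_translation[OF z assms(2)] by metis
  show "limitin T (\<lambda>y. Plus (F y)) (Fs (Minus z)) (at_left z)"
    using limitin_left_point[OF ce(1,3-5)] F_star_Minus[OF assms(2) ce(1,3-5)] by simp
  show "limitin T Plus (Minus z) (at_left z)"
    using limitin_left_point[of 1 z "\<lambda>y. y" 0] z assms(1) by (simp add: left_point_def)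
qed

lemma F_star_in_X:
  assumes "p \<in> X" shows "Fs p \<in> X"
proof (cases p)
  case (Plus x)
  thus ?thesis using assms F_unit_I by simp
next
  case (Minus z)
  show ?thesis
  proof (cases "z = x_hat q \<pi>")
    case False
    thus ?thesis using F_star_limit(1)[of z] assms Minus by (auto simp: limitin_def)
  qed (simp add: Minus)
qed

lemma funpow_F_star_in_X: "p \<in> X \<Longrightarrow> (Fs ^^ n) p \<in> X"
  by (induction n) (auto intro: F_star_in_X)

lemma funpow_F_star_Plus: "(Fs ^^ n) (Plus x) = Plus ((F ^^ n) x)"
  by (induction n) auto

lemma open_contains_interval:
  assumes "openin T W" "W \<noteq> {}"
  obtains u v where "0 \<le> u" "u < v" "v \<le> 1" "\<And>r. r \<in> X \<Longrightarrow> u < base r \<Longrightarrow> base r < v \<Longrightarrow> r \<in> W"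
proof -
  obtain p where p: "p \<in> W" using assms by blast
  hence "p \<in> X" using openin_subset[OF assms(1)] by auto
  show ?thesis
  proof (cases p)
    case (Plus x)
    obtain e where e: "0 < e" "\<forall>r\<in>X. Plus x \<le> r \<and> base r < x + e \<longrightarrow> r \<in> W"
      using right_nbhd[OF assms(1)] p Plus by blast
    have "0 \<le> x" "x < 1" using \<open>p \<in> X\<close> Plus by auto
    thus ?thesis using e
      by (intro that[of x "min 1 (x + e)"]) (auto simp: less_eq_split_point_def Plus_less_iff)
  next
    case (Minus z)
    obtain e where e: "0 < e" "\<forall>r\<in>X. z - e < base r \<and> base r < z \<longrightarrow> r \<in> W"
      using left_nbhd[OF assms(1) p, of z] Minus by blast
    have "0 < z" "z \<le> 1" using \<open>p \<in> X\<close> Minus Minus_in_X_bounds by auto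
    thus ?thesis using e by (intro that[of "max 0 (z - e)" z]) auto
  qed
qed

text \<open>As long as the orbit of \<open>z\<^sup>-\<close> consists of added points, it moves by the same
translations as the real points slightly to the left of \<open>z\<close>.\<close>

lemma left_orbit:
  assumes "Minus z \<in> X"
  shows "(\<exists>m\<le>n. \<exists>x. (Fs ^^ m) (Minus z) = Plus x) \<or>
    (\<exists>c e. 0 < e \<and> e \<le> z \<and> (\<forall>y\<in>{z - e<..<z}. (F ^^ n) y = y + c) \<and> (Fs ^^ n) (Minus z) = Minus (z + c))"
proof (induction n)
  case 0
  show ?case using Minus_in_X_bounds[OF assms] by (intro disjI2 exI[of _ 0] exI[of _ z]) auto
next
  case (Suc n)
  show ?case
  proof (cases "\<exists>m\<le>Suc n. \<exists>x. (Fs ^^ m) (Minus z) = Plus x")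
    case False
    hence "\<not> (\<exists>m\<le>n. \<exists>x. (Fs ^^ m) (Minus z) = Plus x)" using le_SucI by blast
    with Suc obtain c e where ce: "0 < e" "e \<le> z" "\<forall>y\<in>{z - e<..<z}. (F ^^ n) y = y + c"
      and n: "(Fs ^^ n) (Minus z) = Minus (z + c)" by blast
    define w where "w = z + c"
    have w: "Minus w \<in> X" using funpow_F_star_in_X[OF assms, of n] n by (simp add: w_def)
    have step: "(Fs ^^ Suc n) (Minus z) = Fs (Minus w)" using n by (simp add: w_def)
    hence notPlus: "Fs (Minus w) \<noteq> Plus x" for x using False by (metis order_refl)
    have "w \<noteq> x_hat q \<pi>" using notPlus[of 0] by auto
    have "0 < w" "w \<le> 1" using Minus_in_X_bounds[OF w] by auto
    obtain d b where db: "0 < b" "b \<le> w" "\<And>y. y \<in> {w - b<..<w} \<Longrightarrow> F y = y + d"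
      "0 < w + d" "w + d \<le> 1" using F_left_translation[OF \<open>0 < w\<close> \<open>w \<le> 1\<close> \<open>w \<noteq> x_hat q \<pi>\<close>] by metis
    have "Fs (Minus w) = Minus (w + d)"
      using F_star_Minus[OF \<open>w \<noteq> x_hat q \<pi>\<close> db(1,3-5)] notPlus[of "w + d"]
      by (auto simp: left_point_def split: if_splits)
    moreover have "(F ^^ Suc n) y = y + (c + d)" if "y \<in> {z - min e b<..<z}" for y
      using that ce(3) db(3)[of "y + c"] by (auto simp: w_def)
    ultimately show ?thesis using step ce db
      by (intro disjI2 exI[of _ "c + d"] exI[of _ "min e b"]) (auto simp: w_def add.assoc)
  qed auto
qed

end

section \<open>Minimality\<close>

text \<open>The bound \<open>N\<close> is uniform in \<open>x\<close>. This is what makes the property pass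
from real points to added points, which are only approximated by real ones for a bounded number of
steps.\<close>

locale minimal_rotated = rotated +
  assumes uniformly_dense: "\<And>u v. 0 \<le> u \<Longrightarrow> u < v \<Longrightarrow> v \<le> 1 \<Longrightarrow>
    \<exists>N. \<forall>x\<in>unit_I. \<exists>n\<le>N. (F ^^ n) x \<in> {u<..<v}"
begin

text \<open>Shrink \<open>(u, v)\<close> to \<open>(u', v')\<close> and follow a real point \<open>y <
z\<close> so close to \<open>z\<close> that it shares the first \<open>N\<close> translations of
\<open>z\<^sup>-\<close>. When \<open>y\<close> visits \<open>(u', v')\<close>, the added point is in
\<open>(u, v)\<close>.\<close>

lemma F_star_orbit_dense:
  assumes p: "p \<in> X" and uv: "0 \<le> u" "u < v" "v \<le> 1"
  shows "\<exists>n. base ((Fs ^^ n) p) \<in> {u<..<v}"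
proof -
  have Plus: "\<exists>n. base ((Fs ^^ n) (Plus x)) \<in> {u<..<v}" if "x \<in> unit_I" for x
    using uniformly_dense[OF uv] that by (auto simp: funpow_F_star_Plus)
  show ?thesis
  proof (cases "\<exists>m x. (Fs ^^ m) p = Plus x")
    case True
    then obtain m x where mx: "(Fs ^^ m) p = Plus x" by blast
    hence "x \<in> unit_I" using funpow_F_star_in_X[OF p, of m] by simp
    then obtain n where "base ((Fs ^^ n) (Plus x)) \<in> {u<..<v}" using Plus by blast
    thus ?thesis by (intro exI[of _ "n + m"]) (simp add: funpow_add mx)
  next
    case False
    then obtain z where z: "p = Minus z" by (cases p) (metis funpow_0)+
    have "\<exists>c e. 0 < e \<and> e \<le> z \<and> (\<forall>y\<in>{z - e<..<z}. (F ^^ n) y = y + c) \<and> (Fs ^^ n) (Minus z) = Minus (z + c)" for n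
      using left_orbit[of z n] False p unfolding z by blast
    then obtain c e where ce: "\<And>n. 0 < e n \<and> e n \<le> z \<and> (\<forall>y\<in>{z - e n<..<z}. (F ^^ n) y = y + c n) \<and> (Fs ^^ n) (Minus z) = Minus (z + c n)"
      by metis
    \<comment> \<open>The margins of width \<open>(v - u) / 3\<close> absorb the distance between \<open>y\<close> and \<open>z\<close>.\<close>
    define u' v' where "u' = (2 * u + v) / 3" and "v' = (u + 2 * v) / 3"
    have uv': "u < u'" "u' < v'" "v' < v" using uv by (auto simp: u'_def v'_def)
    obtain N where N: "\<forall>x\<in>unit_I. \<exists>n\<le>N. (F ^^ n) x \<in> {u'<..<v'}"
      using uniformly_dense[of u' v'] uv uv' by auto
    define b where "b = min (v - v') (Min (e ` {..N}))"
    have b: "0 < b" "b \<le> v - v'" using uv' ce by (auto simp: b_def)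
    have be: "b \<le> e n" if "n \<le> N" for n
    proof -
      have "Min (e ` {..N}) \<le> e n" using that by (intro Min_le) auto
      thus ?thesis by (simp add: b_def)
    qed
    define y where "y = z - b / 2"
    have "b \<le> z" using be[of 0] ce[of 0] by auto
    moreover have "0 < z" "z \<le> 1" using Minus_in_X_bounds p z by auto
    ultimately have "y \<in> unit_I" using b by (auto simp: y_def)
    then obtain n where n: "n \<le> N" "(F ^^ n) y \<in> {u'<..<v'}" using N by blast
    have "(F ^^ n) y = y + c n" using ce[of n] be[OF n(1)] b by (auto simp: y_def)
    hence "z + c n \<in> {u<..<v}" using n(2) b uv' by (auto simp: y_def)
    thus ?thesis using ce[of n] z by (intro exI[of _ n]) auto
  qed
qed

text \<open>A periodic orbit is finite and would miss an interval \<open>(0, v)\<close>.\<close>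

lemma I_per_empty: "I_per q \<pi> = {}"
proof (rule ccontr)
  assume "I_per q \<pi> \<noteq> {}"
  then obtain x n where xn: "x \<in> unit_I" "n \<ge> 1" "(F ^^ n) x = x" by (auto simp: I_per_def)
  have "(F ^^ (k mod n)) x = (F ^^ k) x" for k by (rule funpow_mod_eq[OF xn(3)])
  \<comment> \<open>The element \<open>1\<close> only guarantees that there is a nonzero element.\<close>
  define Orb where "Orb = insert 1 ((\<lambda>k. (F ^^ k) x) ` {..<n})"
  have orbit: "(F ^^ k) x \<in> Orb" for k
    using xn(2) \<open>(F ^^ (k mod n)) x = (F ^^ k) x\<close>[symmetric] by (auto simp: Orb_def)
  have "finite Orb" by (simp add: Orb_def)
  define v where "v = Min (Orb - {0})"
  have nz: "finite (Orb - {0})" "Orb - {0} \<noteq> {}" using \<open>finite Orb\<close> by (auto simp: Orb_def)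
  have "v \<in> Orb - {0}" unfolding v_def by (rule Min_in[OF nz])
  have "0 \<le> (F ^^ k) x \<and> (F ^^ k) x \<le> 1" for k
    using funpow_F_unit_I[OF xn(1), of k] by auto
  hence "Orb \<subseteq> {0..1}" by (auto simp: Orb_def)
  with \<open>v \<in> Orb - {0}\<close> have v: "0 < v" "v \<le> 1" by force+
  obtain k where k: "(F ^^ k) x \<in> {0<..<v}" using uniformly_dense[of 0 v] v xn(1) by blast
  hence "v \<le> (F ^^ k) x" unfolding v_def using orbit by (intro Min_le[OF nz(1)]) auto
  thus False using k by simp
qed

lemma I_np_star_eq: "I_np_star q \<pi> = X"
  by (force simp: I_np_star_def I_per_star_def I_per_empty)

lemma closed_invariant_eq_X:
  assumes "N \<noteq> {}" "closedin T N" "Fs ` N \<subseteq> N"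
  shows "N = X"
proof (rule ccontr)
  assume "N \<noteq> X"
  have NX: "N \<subseteq> X" using closedin_subset[OF assms(2)] by simp
  with \<open>N \<noteq> X\<close> have ne: "X - N \<noteq> {}" by blast
  have "openin T (X - N)" using assms(2) by (simp add: closedin_def)
  from open_contains_interval[OF this ne] obtain u v where uv: "0 \<le> u" "u < v" "v \<le> 1"
    "\<And>r. r \<in> X \<Longrightarrow> u < base r \<Longrightarrow> base r < v \<Longrightarrow> r \<in> X - N" by metis
  obtain p where p: "p \<in> N" using assms(1) by blast
  have N: "(Fs ^^ n) p \<in> N" for n using p assms(3) by (induction n) auto
  obtain n where "base ((Fs ^^ n) p) \<in> {u<..<v}"
    using F_star_orbit_dense[of p u v] p NX uv by blast
  thus False using uv(4)[of "(Fs ^^ n) p"] N[of n] NX by auto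
qed

lemma I_min_star_eq: "I_min_star q \<pi> = X"
proof -
  have T: "subtopology T X = T" using subtopology_topspace[of T] by simp
  have "minimal_set T Fs X" unfolding minimal_set_def
  proof (intro conjI allI impI)
    have "Plus 0 \<in> X" by simp
    thus "X \<noteq> {}" by blast
    show "closedin T X" using closedin_topspace[of T] by simp
    show "Fs ` X \<subseteq> X" using F_star_in_X by blast
  qed (use closed_invariant_eq_X in blast)
  moreover have "M = X" if "minimal_set T Fs M" for M
    using that closed_invariant_eq_X by (auto simp: minimal_set_def)
  ultimately show ?thesis unfolding I_min_star_def I_np_star_eq T by (rule the_equality)
qed

lemma top_min_eq: "top_min q \<pi> = T"
  using subtopology_topspace[of T] by (simp add: top_min_def I_min_star_eq)

end

section \<open>The unrotated map and binary digits\<close>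

lemma odometer_uniformly_dense:
  assumes "0 \<le> u" "u < v" "v \<le> 1"
  shows "\<exists>N. \<forall>x\<in>unit_I. \<exists>n\<le>N. (odo ^^ n) x \<in> {u<..<v}"
proof -
  obtain k j :: nat where kj: "j < 2 ^ k" "u < j / 2 ^ k" "(j + 1) / 2 ^ k < v"
    using dyadic_cell_in_interval[OF assms] .
  have "\<exists>n\<le>2 * 2 ^ k. (odo ^^ n) x \<in> {u<..<v}" if x: "x \<in> unit_I" for x
  proof -
    obtain n where n: "n \<le> 2 * 2 ^ k" "(odo ^^ n) x \<in> {j / 2 ^ k ..< (j + 1) / 2 ^ k}"
      using odometer_visits_dyadic_cell[OF x kj(1)] by blast
    have "u < (odo ^^ n) x" "(odo ^^ n) x < v" using n(2) kj unfolding atLeastLessThan_iff by linarith+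
    thus ?thesis using n(1) by auto
  qed
  thus ?thesis by blast
qed

text \<open>The index \<open>j\<close> of the dyadic interval of level \<open>k\<close> that contains the
point. Added points count to the interval on their left, so that cells are the order intervals from \<open>(j
/ 2\<^sup>k)\<^sup>+\<close> to \<open>((j + 1) / 2\<^sup>k)\<^sup>-\<close>.\<close>

primrec cell_index :: "nat \<Rightarrow> split_point \<Rightarrow> int" where
  "cell_index k (Plus x) = \<lfloor>x * 2 ^ k\<rfloor>"
| "cell_index k (Minus x) = \<lceil>x * 2 ^ k\<rceil> - 1"

definition digit :: "nat \<Rightarrow> split_point \<Rightarrow> bool" where
  "digit n p \<longleftrightarrow> odd (cell_index (Suc n) p)"

lemma cell_index_eq_iff:
  "cell_index k p = j \<longleftrightarrow> Plus (j / 2 ^ k) \<le> p \<and> p < Plus ((j + 1) / 2 ^ k)"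
proof (cases p)
  case (Plus x)
  have "cell_index k p = j \<longleftrightarrow> j \<le> x * 2 ^ k \<and> x * 2 ^ k < j + 1"
    by (simp add: Plus floor_eq_iff)
  thus ?thesis by (auto simp: Plus less_eq_split_point_def less_split_point_def le_less field_simps)
next
  case (Minus x)
  have "cell_index k p = j \<longleftrightarrow> j < x * 2 ^ k \<and> x * 2 ^ k \<le> j + 1"
    by (simp add: Minus ceiling_eq_iff eq_diff_eq diff_eq_eq)
  thus ?thesis by (auto simp: Minus less_eq_split_point_def less_split_point_def le_less field_simps)
qed

lemma digit_0_Plus: "x \<in> unit_I \<Longrightarrow> digit 0 (Plus x) \<longleftrightarrow> 1/2 \<le> x"
proof -
  assume x: "x \<in> unit_I"
  show ?thesis
  proof (cases "1/2 \<le> x")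
    case True
    hence "\<lfloor>x * 2\<rfloor> = 1" using x by (simp add: floor_eq_iff)
    thus ?thesis using True by (simp add: digit_def)
  next
    case False
    hence "\<lfloor>x * 2\<rfloor> = 0" using x by (simp add: floor_eq_iff)
    thus ?thesis using False by (simp add: digit_def)
  qed
qed

lemma digit_Suc_Plus: "digit (Suc n) (Plus x) \<longleftrightarrow> digit n (Plus (2 * x))"
  by (simp add: digit_def mult_ac)

lemma digit_Plus_add_1: "digit n (Plus (x + 1)) \<longleftrightarrow> digit n (Plus x)"
proof -
  have "(x + 1) * 2 ^ Suc n = x * 2 ^ Suc n + of_int (2 ^ Suc n)" by (simp add: algebra_simps)
  hence "\<lfloor>(x + 1) * 2 ^ Suc n\<rfloor> = \<lfloor>x * 2 ^ Suc n\<rfloor> + 2 ^ Suc n"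
    by (simp only: floor_add_int)
  thus ?thesis by (simp add: digit_def)
qed

text \<open>In the left half \<open>a\<close> only flips the leading digit. In the right half it clears the
leading digit and continues on the remaining ones, which is the carry.\<close>

lemma digit_odometer_Plus:
  assumes "x \<in> unit_I"
  shows "digit n (Plus (odo x)) \<longleftrightarrow> dyadic_odometer (\<lambda>k. digit k (Plus x)) n"
  using assms
proof (induction n arbitrary: x)
  case 0
  have "1/2 \<le> odo x \<longleftrightarrow> \<not> 1/2 \<le> x"
  proof (cases "1/2 \<le> x")
    case True
    have "odo (2 * x - 1) \<in> unit_I" using True 0 by (intro odometer_unit_I) auto
    thus ?thesis using odometer_high'[of x] True 0 by auto
  qed (use 0 odometer_low[of x] in auto)
  thus ?case using 0 digit_0_Plus odometer_unit_I[OF 0] by (simp add: dyadic_odometer_def)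
next
  case (Suc n)
  show ?case
  proof (cases "1/2 \<le> x")
    case True
    have y: "2 * x - 1 \<in> unit_I" using True Suc.prems by auto
    have shift: "digit (Suc k) (Plus x) \<longleftrightarrow> digit k (Plus (2 * x - 1))" for k
      using digit_Plus_add_1[of k "2 * x - 1"] by (simp add: digit_Suc_Plus)
    have "digit (Suc n) (Plus (odo x)) \<longleftrightarrow> digit n (Plus (odo (2 * x - 1)))"
    proof -
      have "2 * odo x = odo (2 * x - 1)" using odometer_high'[of x] True Suc.prems by auto
      thus ?thesis by (simp only: digit_Suc_Plus)
    qed
    also have "\<dots> \<longleftrightarrow> dyadic_odometer (\<lambda>k. digit k (Plus (2 * x - 1))) n" by (rule Suc.IH[OF y])
    also have "\<dots> \<longleftrightarrow> dyadic_odometer (\<lambda>k. digit k (Plus x)) (Suc n)"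
      using True digit_0_Plus[OF Suc.prems] by (simp add: dyadic_odometer_def All_less_Suc2 shift)
    finally show ?thesis .
  next
    case False
    have "digit (Suc n) (Plus (odo x)) \<longleftrightarrow> digit (Suc n) (Plus x)"
      using odometer_low[of x] False Suc.prems digit_Plus_add_1[of n "2 * x"]
      by (simp add: digit_Suc_Plus algebra_simps)
    thus ?thesis using False digit_0_Plus[OF Suc.prems] by (auto simp: dyadic_odometer_def)
  qed
qed

lemma rotated_odometer_id: "rotated_odometer q id = odo"
  by (rule ext) (simp add: rotated_odometer_def rot_def)

locale unrotated = rotated q id for q
begin

lemma F_eq: "F = odo"
  by (rule rotated_odometer_id)

sublocale minimal_rotated q id
  by standard (use odometer_uniformly_dense F_eq in simp)

text \<open>Dyadic rationals are on the forward orbit of \<open>0\<close>.\<close>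

lemma dyadic_in_D:
  assumes "j < 2 ^ k" shows "real j / 2 ^ k \<in> D q id"
proof -
  obtain n where "(odo ^^ n) 0 = real j / 2 ^ k + 0"
    using odometer_reaches_dyadic_cell[OF assms] by force
  moreover have "0 \<in> D0 q id" by (simp add: D0_def)
  ultimately show ?thesis 
    unfolding D_def F_eq by (intro UnI1 CollectI exI[of _ n] exI[of _ 0]) simp
qed

text \<open>A lower end point \<open>c\<close> of a cell with \<open>0 < c\<close> is split, so being at least
\<open>c\<^sup>+\<close> is the same as being greater than \<open>c\<^sup>-\<close>, which is an open
condition.\<close>

lemma openin_cell: "openin T {p \<in> X. cell_index k p = j}"
proof -
  have upper: "openin T {p \<in> X. p < Plus c}" for c
  proof (cases "0 \<le> c \<and> c < 1")
    case True
    thus ?thesis using openin_order_topology_on_rays(1)[of "Plus c" X] by (simp add: top_star_def)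
  next
    case False
    have "{p \<in> X. p < Plus c} = (if c < 0 then {} else X)"
      using False Minus_in_X_bounds by (auto simp: less_Plus_iff I_star_def) force+
    thus ?thesis using openin_topspace[of T] by simp
  qed
  have "openin T {p \<in> X. Plus (j / 2 ^ k) \<le> p}"
  proof (cases "0 < j \<and> j < 2 ^ k")
    case True
    then obtain i where i: "j = int i" by (metis less_imp_le nonneg_int_cases)
    have "i < 2 ^ k" using True by (simp add: i)
    from dyadic_in_D[OF this] have "Minus (j / 2 ^ k) \<in> X"
      using True by (simp add: Minus_in_X_iff i)
    moreover have "{p \<in> X. Plus (j / 2 ^ k) \<le> p} = {p \<in> X. Minus (j / 2 ^ k) < p}"
      by (auto simp: less_eq_split_point_def Minus_less_iff Plus_less_iff)
    ultimately show ?thesis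
      using openin_order_topology_on_rays(2)[of "Minus (j / 2 ^ k)" X] by (simp add: top_star_def)
  next
    case False
    have low: "Plus c \<le> p" if "c \<le> 0" "p \<in> X" for c p
      using that Minus_in_X_bounds by (cases p) (force simp: less_eq_split_point_def Plus_less_iff)+
    have high: "\<not> Plus c \<le> p" if "1 \<le> c" "p \<in> X" for c p
      using that Minus_in_X_bounds by (cases p) (force simp: less_eq_split_point_def Plus_less_iff)+
    have "{p \<in> X. Plus (j / 2 ^ k) \<le> p} = (if j \<le> 0 then X else {})"
    proof (cases "j \<le> 0")
      case True
      hence "j / 2 ^ k \<le> (0::real)" by (simp add: divide_le_0_iff)
      thus ?thesis using low True by auto
    next
      case j: False
      hence "2 ^ k \<le> j" using False by simp
      hence "(2::real) ^ k \<le> j" by (metis of_int_le_iff of_int_numeral of_int_power)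
      hence "1 \<le> j / (2::real) ^ k" by simp
      thus ?thesis using high j by auto
    qed
    thus ?thesis using openin_topspace[of T] by simp
  qed
  hence "openin T ({p \<in> X. Plus (j / 2 ^ k) \<le> p} \<inter> {p \<in> X. p < Plus ((j + 1) / 2 ^ k)})"
    using upper by (rule openin_Int)
  moreover have "{p \<in> X. cell_index k p = j}
      = {p \<in> X. Plus (j / 2 ^ k) \<le> p} \<inter> {p \<in> X. p < Plus ((j + 1) / 2 ^ k)}"
    unfolding cell_index_eq_iff by auto
  ultimately show ?thesis by simp
qed

lemma digit_limit:
  assumes "limitin T f p G" shows "\<forall>\<^sub>F y in G. digit n (f y) = digit n p"
proof -
  have "p \<in> X" using assms by (simp add: limitin_def)
  hence "\<forall>\<^sub>F y in G. f y \<in> {r \<in> X. cell_index (Suc n) r = cell_index (Suc n) p}"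
    using assms openin_cell unfolding limitin_def by blast
  thus ?thesis by (rule eventually_mono) (simp add: digit_def)
qed

text \<open>For an added point both sides are limits along real points from the left, where the identity is
\<open>digit_odometer_Plus\<close>. The last point \<open>1\<^sup>-\<close>, with all digits 1, is sent to
\<open>0\<close>.\<close>

lemma digit_F_star:
  assumes "p \<in> X"
  shows "digit n (Fs p) \<longleftrightarrow> dyadic_odometer (\<lambda>k. digit k p) n"
proof (cases p)
  case (Plus x)
  thus ?thesis using assms digit_odometer_Plus[of x n] by (simp add: F_eq)
next
  case (Minus z)
  have "x_hat q id = 1" using x_hat_eq[of "q - 1"] q_pos by (simp add: of_nat_diff)
  show ?thesis
  proof (cases "z = 1")
    case True
    have ceil: "\<lceil>(2::real) ^ Suc k\<rceil> = 2 ^ Suc k" for k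
      by (metis ceiling_of_int of_int_numeral of_int_power)
    have "digit k (Minus 1)" for k by (simp add: digit_def ceil del: power_Suc)
    moreover have "\<not> digit n (Plus 0)" by (simp add: digit_def)
    ultimately show ?thesis
      using True Minus F_star_x_hat \<open>x_hat q id = 1\<close> by (simp add: dyadic_odometer_def)
  next
    case False
    hence z: "Minus z \<in> X" "z \<noteq> x_hat q id" using assms Minus \<open>x_hat q id = 1\<close> by auto
    have "\<forall>\<^sub>F y in at_left z. \<forall>k\<in>{..n}. digit k (Plus y) = digit k (Minus z)"
      by (rule eventually_ball_finite) (use digit_limit[OF F_star_limit(2)[OF z]] in auto)
    moreover have "\<forall>\<^sub>F y in at_left z. digit n (Plus (F y)) = digit n (Fs (Minus z))"
      by (rule digit_limit[OF F_star_limit(1)[OF z]])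
    moreover have "\<forall>\<^sub>F y in at_left z. y \<in> unit_I"
      using Minus_in_X_bounds[OF z(1)] unfolding eventually_at_left_field
      by (intro exI[of _ 0]) auto
    ultimately have "\<forall>\<^sub>F y in at_left z. digit n (Fs p) \<longleftrightarrow> dyadic_odometer (\<lambda>k. digit k p) n"
    proof eventually_elim
      case (elim y)
      have "digit n (Fs p) \<longleftrightarrow> dyadic_odometer (\<lambda>k. digit k (Plus y)) n"
        using elim digit_odometer_Plus[of y n] by (simp add: Minus F_eq)
      thus ?case using elim by (simp add: dyadic_odometer_def Minus)
    qed
    thus ?thesis by (simp add: eventually_const_iff)
  qed
qed

lemma continuous_map_digits: "continuous_map T cantor_topology (\<lambda>p n. digit n p)"
  unfolding cantor_topology_def continuous_map_componentwise_UNIV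
proof
  fix n
  have "openin T {p \<in> X. digit n p \<in> U}" for U
  proof (subst openin_subopen, intro ballI)
    fix p assume "p \<in> {p \<in> X. digit n p \<in> U}"
    thus "\<exists>V. openin T V \<and> p \<in> V \<and> V \<subseteq> {p \<in> X. digit n p \<in> U}"
      by (intro exI[of _ "{r \<in> X. cell_index (Suc n) r = cell_index (Suc n) p}"])
        (auto simp: openin_cell digit_def)
  qed
  thus "continuous_map T (discrete_topology UNIV) (digit n)"
    by (simp add: continuous_map_def)
qed

text \<open>The cells prescribed by the digits are nested with lower ends \<open>l k\<close> and upper ends
\<open>u k\<close>. If the supremum \<open>r\<close> of the lower ends is below all upper ends,
\<open>r\<^sup>+\<close> has the digits. Otherwise the digits end in ones and \<open>r\<close> is an upper
end; then \<open>r\<^sup>-\<close> has them.\<close>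

lemma digits_surjective:
  obtains p where "p \<in> X" "\<And>n. digit n p = \<omega> n"
proof -
  define J :: "nat \<Rightarrow> int" where "J = rec_nat 0 (\<lambda>k j. 2 * j + of_bool (\<omega> k))"
  have J: "J 0 = 0" "J (Suc k) = 2 * J k + of_bool (\<omega> k)" for k by (simp_all add: J_def)
  define l u :: "nat \<Rightarrow> real" where "l k = J k / 2 ^ k" and "u k = (J k + 1) / 2 ^ k" for k
  have "incseq l" by (rule incseq_SucI) (simp add: l_def J field_simps)
  have "decseq u" by (rule decseq_SucI) (simp add: u_def J field_simps)
  have lu: "l k \<le> u m" for k m
  proof -
    have "l k \<le> l (max k m)" using \<open>incseq l\<close> by (simp add: incseqD)
    also have "\<dots> \<le> u (max k m)" by (simp add: l_def u_def divide_right_mono)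
    also have "\<dots> \<le> u m" using \<open>decseq u\<close> by (simp add: decseqD)
    finally show ?thesis .
  qed
  define r where "r = (SUP k. l k)"
  have "bdd_above (range l)" using lu[of _ 0] by (intro bdd_aboveI[of _ "u 0"]) auto
  hence lr: "l k \<le> r" for k unfolding r_def by (rule cSUP_upper[OF UNIV_I])
  have ru: "r \<le> u k" for k unfolding r_def by (rule cSUP_least) (use lu in auto)
  have r01: "0 \<le> r" "r \<le> 1" using lr[of 0] ru[of 0] by (simp_all add: l_def u_def J)
  have suffices: "digit n p = \<omega> n" if "\<And>k. Plus (l k) \<le> p \<and> p < Plus (u k)" for p n
  proof -
    have "cell_index (Suc n) p = J (Suc n)"
      using that[of "Suc n"] unfolding cell_index_eq_iff l_def u_def by simp
    thus ?thesis by (simp add: digit_def J)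
  qed
  show ?thesis
  proof (cases "\<forall>k. r < u k")
    case True
    have "r < 1" using True[rule_format, of 0] by (simp add: u_def J)
    moreover have "Plus (l k) \<le> Plus r \<and> Plus r < Plus (u k)" for k
      using True lr[of k] by (auto simp: less_eq_split_point_def less_split_point_def)
    ultimately show ?thesis using r01 suffices by (intro that[of "Plus r"]) auto
  next
    case False
    then obtain K where "r = u K" using ru by (meson le_less)
    have "l k < r" for k
    proof -
      have "l k \<le> l (max k K)" using \<open>incseq l\<close> by (simp add: incseqD)
      also have "\<dots> < u (max k K)" by (simp add: l_def u_def divide_strict_right_mono)
      also have "\<dots> \<le> r" using \<open>decseq u\<close> \<open>r = u K\<close> by (simp add: decseqD)
      finally show ?thesis .
    qed
    hence cell: "Plus (l k) \<le> Minus r \<and> Minus r < Plus (u k)" for k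
      using ru[of k] by (auto simp: less_eq_split_point_def less_split_point_def)
    have "0 < r" using \<open>l 0 < r\<close> by (simp add: l_def J)
    have "J k \<ge> 0" for k by (induction k) (auto simp: J)
    then obtain j where j: "J K + 1 = int j" by (metis add_increasing2 zero_le_one nonneg_int_cases)
    have "Minus r \<in> X"
    proof (cases "r = 1")
      case False
      have "r = real j / 2 ^ K" using \<open>r = u K\<close> j by (simp add: u_def)
      moreover have "real j < 2 ^ K" using False r01 calculation by (simp add: field_simps)
      hence "j < 2 ^ K" by (metis of_nat_less_iff of_nat_numeral of_nat_power)
      ultimately have "r \<in> D q id" using dyadic_in_D by simp
      thus ?thesis using \<open>0 < r\<close> by (simp add: Minus_in_X_iff)
    qed (simp add: Minus_in_X_iff)
    thus ?thesis using suffices[OF cell] by (intro that[of "Minus r"]) auto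
  qed
qed

theorem factor_onto_dyadic_odometer:
  "topological_factor (top_min q id) (F_star q id) cantor_topology dyadic_odometer"
  unfolding topological_factor_def top_min_eq
proof (intro exI conjI ballI)
  show "continuous_map T cantor_topology (\<lambda>p n. digit n p)" by (rule continuous_map_digits)
  show "(\<lambda>p n. digit n p) ` topspace T = topspace cantor_topology"
  proof -
    have "\<omega> \<in> (\<lambda>p n. digit n p) ` X" for \<omega>
    proof -
      obtain p where "p \<in> X" "\<And>n. digit n p = \<omega> n" using digits_surjective[of \<omega>] by metis
      thus ?thesis by (intro image_eqI[of _ _ p]) auto
    qed
    thus ?thesis by (auto simp: cantor_topology_def)
  qed
  fix p assume "p \<in> topspace T"
  thus "(\<lambda>n. digit n (Fs p)) = dyadic_odometer (\<lambda>n. digit n p)"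
    using digit_F_star by (intro ext) simp
qed

end

section \<open>Invariant measures\<close>

text \<open>Sets that are open in the lower limit topology differ from an open set by a countable set.\<close>

lemma borel_if_right_open:
  fixes A :: "real set"
  assumes "\<And>x. x \<in> A \<Longrightarrow> \<exists>e>0. {x..<x + e} \<subseteq> A"
  shows "A \<in> sets borel"
proof -
  obtain e where e: "\<And>x. x \<in> A \<Longrightarrow> 0 < e x" "\<And>x. x \<in> A \<Longrightarrow> {x..<x + e x} \<subseteq> A"
    using assms by metis
  define W where "W = (\<Union>x\<in>A. {x<..<x + e x})"
  have "countable (A - W)" unfolding W_def by (rule countable_not_right_covered[OF e(1)])
  hence "A - W \<in> sets borel" by (rule sets.countable[rotated]) simp
  moreover have "W \<in> sets borel" unfolding W_def by (intro borel_open open_UN) auto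
  moreover have "{x<..<x + e x} \<subseteq> A" if "x \<in> A" for x
    using e(2)[OF that] by (rule order_trans[rotated]) auto
  hence "W \<subseteq> A" unfolding W_def by blast
  hence "A = W \<union> (A - W)" by blast
  ultimately show ?thesis by (metis sets.Un)
qed

text \<open>Translating the pieces on which \<open>f\<close> moves by a constant shows that the preimage of
any set has at most the measure of that set. Applying this to \<open>B\<close> and its complement gives
equality, because the two preimages together fill the interval.\<close>

lemma countable_translations_preserve_lebesgue:
  fixes f :: "real \<Rightarrow> real"
  assumes f: "f \<in> borel_measurable (restrict_space borel unit_I)" "f ` unit_I \<subseteq> unit_I" "inj_on f unit_I"
    and countable: "countable ((\<lambda>x. f x - x) ` unit_I)"
    and B: "B \<in> sets borel" "B \<subseteq> unit_I"
  shows "emeasure lborel {x \<in> unit_I. f x \<in> B} = emeasure lborel B"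
proof -
  let ?P = "\<lambda>B. {x \<in> unit_I. f x \<in> B}"
  have meas: "{x \<in> unit_I. g x \<in> B} \<in> sets borel"
    if "g \<in> borel_measurable (restrict_space borel unit_I)" "B \<in> sets borel" for g :: "real \<Rightarrow> real" and B
  proof -
    have "g -` B \<inter> space (restrict_space borel unit_I) \<in> sets (restrict_space borel unit_I)"
      by (rule measurable_sets[OF that])
    moreover have "g -` B \<inter> space (restrict_space borel unit_I) = {x \<in> unit_I. g x \<in> B}"
      by (auto simp: space_restrict_space)
    ultimately show ?thesis by (subst (asm) sets_restrict_space_iff) auto
  qed
  have le: "emeasure lborel (?P B) \<le> emeasure lborel B" if B: "B \<in> sets borel" for B
  proof -
    \<comment> \<open>\<open>Q c\<close> is the part of the preimage on which \<open>f\<close> translates by \<open>c\<close>, and \<open>Q' c\<close> is its image.\<close>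
    define C where "C = (\<lambda>x. f x - x) ` unit_I"
    define Q where "Q = (\<lambda>c. {x \<in> unit_I. f x - x = c \<and> f x \<in> B})"
    define Q' where "Q' = (\<lambda>c. {y. y - c \<in> Q c})"
    have Q: "Q c \<in> sets borel" for c
    proof -
      have "Q c = {x \<in> unit_I. f x - x \<in> {c}} \<inter> ?P B" by (auto simp: Q_def)
      moreover have "(\<lambda>x::real. x) \<in> borel_measurable (restrict_space borel unit_I)"
        by (rule measurable_restrict_space1) (rule measurable_ident_sets, rule refl)
      hence "(\<lambda>x. f x - x) \<in> borel_measurable (restrict_space borel unit_I)"
        by (rule borel_measurable_diff[OF f(1)])
      hence "{x \<in> unit_I. f x - x \<in> {c}} \<in> sets borel" by (rule meas) simp
      ultimately show ?thesis using sets.Int[OF _ meas[OF f(1) B]] by simp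
    qed
    have Q': "Q' c \<in> sets borel" for c
    proof -
      have "(\<lambda>y. y - c) -` Q c \<inter> space borel \<in> sets borel" by (rule measurable_sets[OF _ Q]) simp
      thus ?thesis by (simp add: Q'_def vimage_def)
    qed
    have same: "emeasure lborel (Q c) = emeasure lborel (Q' c)" for c
    proof -
      have "emeasure lborel (Q' c) = emeasure (distr lborel borel ((+) c)) (Q' c)"
        by (simp add: lborel_distr_plus)
      also have "\<dots> = emeasure lborel ((+) c -` Q' c)"
        using Q' by (subst emeasure_distr) auto
      also have "(+) c -` Q' c = Q c" by (auto simp: Q'_def)
      finally show ?thesis by simp
    qed
    have "?P B = (\<Union>c\<in>C. Q c)" by (auto simp: Q_def C_def)
    moreover have "disjoint_family_on Q C" by (auto simp: disjoint_family_on_def Q_def)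
    moreover have "countable C" unfolding C_def by (rule countable)
    ultimately have "emeasure lborel (?P B) = (\<integral>\<^sup>+c. emeasure lborel (Q c) \<partial>count_space C)"
      using Q by (simp only: emeasure_UN_countable sets_lborel)
    also have "\<dots> = (\<integral>\<^sup>+c. emeasure lborel (Q' c) \<partial>count_space C)"
      by (simp add: same)
    also have "\<dots> = emeasure lborel (\<Union>c\<in>C. Q' c)"
    proof (rule emeasure_UN_countable[symmetric])
      have "c = d" if "y - c \<in> Q c" "y - d \<in> Q d" for c d y
      proof -
        have "f (y - c) = y" "f (y - d) = y" "y - c \<in> unit_I" "y - d \<in> unit_I"
          using that by (auto simp: Q_def)
        hence "y - c = y - d" using f(3) by (metis inj_onD)
        thus ?thesis by simp
      qed
      thus "disjoint_family_on Q' C" unfolding disjoint_family_on_def Q'_def by blast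
    qed (use Q' \<open>countable C\<close> in simp_all)
    also have "\<dots> \<le> emeasure lborel B"
      by (rule emeasure_mono) (use B in \<open>auto simp: Q'_def Q_def\<close>)
    finally show ?thesis .
  qed
  have fin: "emeasure lborel A = ennreal (measure lborel A)" if "A \<subseteq> unit_I" "A \<in> sets borel" for A
  proof (rule emeasure_eq_ennreal_measure)
    have "emeasure lborel A \<le> emeasure lborel unit_I" by (rule emeasure_mono) (use that in auto)
    thus "emeasure lborel A \<noteq> \<top>" by (auto simp: top_unique)
  qed
  have B': "unit_I - B \<subseteq> unit_I" "unit_I - B \<in> sets borel" using B by auto
  have PB: "?P B \<subseteq> unit_I" "?P B \<in> sets borel" "?P (unit_I - B) \<subseteq> unit_I" "?P (unit_I - B) \<in> sets borel"
    using meas[OF f(1) B(1)] meas[OF f(1) B'(2)] by blast+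
  have "measure lborel (?P B) \<le> measure lborel B"
    using le[OF B(1)] fin[OF PB(1,2)] fin[OF B(2,1)] by simp
  moreover have "measure lborel (?P (unit_I - B)) \<le> measure lborel (unit_I - B)"
    using le[OF B'(2)] fin[OF PB(3,4)] fin[OF B'] by simp
  moreover have "emeasure lborel (?P B) + emeasure lborel (?P (unit_I - B)) = emeasure lborel (?P B \<union> ?P (unit_I - B))"
    using PB by (intro plus_emeasure) auto
  moreover have "?P B \<union> ?P (unit_I - B) = unit_I" using f(2) by auto
  moreover have "emeasure lborel B + emeasure lborel (unit_I - B) = emeasure lborel (B \<union> (unit_I - B))"
    using B B' by (intro plus_emeasure) auto
  moreover have "B \<union> (unit_I - B) = unit_I" using B(2) by auto
  ultimately have "measure lborel (?P B) = measure lborel B"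
    unfolding fin[OF PB(1,2)] fin[OF PB(3,4)] fin[OF B(2,1)] fin[OF B']
    by (simp flip: ennreal_plus)
  thus ?thesis using fin[OF PB(1,2)] fin[OF B(2,1)] by simp
qed

context rotated
begin

lemma F_measurable: "F \<in> borel_measurable (restrict_space borel unit_I)"
proof (rule borel_measurableI)
  fix S :: "real set" assume "open S"
  have "{x \<in> unit_I. F x \<in> S} \<in> sets borel"
  proof (rule borel_if_right_open)
    fix x assume x: "x \<in> {x \<in> unit_I. F x \<in> S}"
    hence xI: "x \<in> unit_I" and "F x \<in> S" by auto
    obtain c e where ce: "0 < e" "x + e \<le> 1" "\<And>y. y \<in> {x..<x + e} \<Longrightarrow> F y = y + c"
      using F_right_translation[OF xI] by metis
    obtain d where d: "0 < d" "ball (F x) d \<subseteq> S" using openE[OF \<open>open S\<close> \<open>F x \<in> S\<close>] .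
    have "F y \<in> S" if "y \<in> {x..<x + min e d}" for y
    proof -
      have "F y = y + c" "F x = x + c" using ce that by auto
      hence "F y \<in> ball (F x) d" using that by (auto simp: dist_real_def)
      thus ?thesis using d by blast
    qed
    thus "\<exists>e>0. {x..<x + e} \<subseteq> {x \<in> unit_I. F x \<in> S}"
      using ce d x by (intro exI[of _ "min e d"]) auto
  qed
  moreover have "F -` S \<inter> space (restrict_space borel unit_I) = {x \<in> unit_I. F x \<in> S}"
    by (auto simp: space_restrict_space)
  ultimately show "F -` S \<inter> space (restrict_space borel unit_I) \<in> sets (restrict_space borel unit_I)"
    by (subst sets_restrict_space_iff) auto
qed

lemma F_vimage_borel:
  assumes "B \<in> sets borel" shows "{x \<in> unit_I. F x \<in> B} \<in> sets borel"
proof -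
  have "F -` B \<inter> space (restrict_space borel unit_I) \<in> sets (restrict_space borel unit_I)"
    by (rule measurable_sets[OF F_measurable assms])
  moreover have "F -` B \<inter> space (restrict_space borel unit_I) = {x \<in> unit_I. F x \<in> B}"
    by (auto simp: space_restrict_space)
  ultimately show ?thesis by (subst (asm) sets_restrict_space_iff) auto
qed

lemma F_preserves_lebesgue:
  assumes "B \<in> sets borel" "B \<subseteq> unit_I"
  shows "emeasure lborel {x \<in> unit_I. F x \<in> B} = emeasure lborel B"
proof (rule countable_translations_preserve_lebesgue[OF F_measurable _ inj_on_F _ assms])
  show "F ` unit_I \<subseteq> unit_I" using F_unit_I by blast
  have "F x - x \<in> (\<lambda>(i, n). (real (\<pi> i) - real i) / q - (1 - 3 / 2 ^ n)) ` (UNIV :: (nat \<times> nat) set)"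
    if x: "x \<in> unit_I" for x
  proof -
    obtain i where i: "i < q" "real i / q \<le> x" "x < (real i + 1) / q" using letter_of[OF x] .
    obtain n where n: "n \<ge> 1" "1 - 1 / 2 ^ (n - 1) \<le> R x" "R x < 1 - 1 / 2 ^ n"
      using unit_I_cell[OF rot_unit_I[OF x]] .
    have "F x = odo (R x)" by (simp add: rotated_odometer_def)
    also have "\<dots> = x + (real (\<pi> i) - real i) / q - (1 - 3 / 2 ^ n)"
      using odometer_on_cell[OF n] rot_on_letter[OF i(2,3)] by simp
    finally show ?thesis by (intro image_eqI[of _ _ "(i, n)"]) auto
  qed
  thus "countable ((\<lambda>x. F x - x) ` unit_I)"
    by (intro countable_subset[OF _ countable_image[OF countableI_type]]) blast
qed

abbreviation S :: "split_point set set" where "S \<equiv> sigma_sets X {U. openin T U}"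

lemma open_subsets_Pow: "{U. openin T U} \<subseteq> Pow X"
  using openin_subset[of T] by auto

sublocale S: sigma_algebra X S
  by (rule sigma_algebra_sigma_sets[OF open_subsets_Pow])

lemma singleton_in_S:
  assumes "p \<in> X" shows "{p} \<in> S"
proof -
  have "closedin T {p}"
    by (rule closedin_Hausdorff_singleton) (use assms in \<open>auto simp: top_star_def Hausdorff_order_topology_on\<close>)
  hence "openin T (X - {p})" by (simp add: closedin_def)
  hence "X - (X - {p}) \<in> S" by (intro sigma_sets.Compl sigma_sets.Basic) simp
  moreover have "X - (X - {p}) = {p}" using assms by blast
  ultimately show ?thesis by simp
qed

lemma base_vimage_in_S:
  assumes "B \<in> sets borel" shows "{p \<in> X. base p \<in> B} \<in> S"
proof -
  have "base \<in> borel_measurable (sigma X {U. openin T U})"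
    unfolding borel_measurable_iff_less
  proof
    fix a
    have "{p \<in> X. base p < a} \<in> S"
    proof (cases "Minus a \<in> X")
      case True
      have "{p \<in> X. base p < a} = {p \<in> X. p < Minus a}" by (simp add: less_Minus_iff)
      thus ?thesis using openin_order_topology_on_rays(1)[OF True]
        by (simp add: sigma_sets.Basic top_star_def)
    next
      case no_minus: False
      show ?thesis
      proof (cases "a \<in> unit_I")
        case True
        hence "Plus a \<in> X" by simp
        moreover have "{p \<in> X. base p < a} = {p \<in> X. p < Plus a}"
          using no_minus by (auto simp: less_Plus_iff)
        ultimately show ?thesis using openin_order_topology_on_rays(1)[of "Plus a" X]
          by (simp add: sigma_sets.Basic top_star_def)
      next
        case False
        have "0 \<le> base p \<and> base p \<le> 1" if "p \<in> X" for p
          using that Minus_in_X_bounds by (cases p) force+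
        moreover have "a \<noteq> 1" using no_minus by (auto simp: Minus_in_X_iff)
        ultimately have "{p \<in> X. base p < a} = (if a < 0 then {} else X)"
          using False by fastforce
        thus ?thesis by (simp add: S.top)
      qed
    qed
    thus "{p \<in> space (sigma X {U. openin T U}). base p < a} \<in> sets (sigma X {U. openin T U})"
      using open_subsets_Pow by (simp add: space_measure_of sets_measure_of)
  qed
  from measurable_sets[OF this assms] show ?thesis
    using open_subsets_Pow by (simp add: space_measure_of sets_measure_of vimage_def Int_def conj_commute)
qed

definition added_points :: "split_point set" where
  "added_points = X \<inter> range Minus"

lemma countable_added_points: "countable added_points"
proof -
  have "added_points \<subseteq> Minus ` (D q \<pi> \<union> {1})" by (auto simp: added_points_def Minus_in_X_iff)
  thus ?thesis using countable_D by (meson countable_Un countable_finite countable_image countable_subset finite.intros)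
qed

lemma countable_in_S:
  assumes "countable A" "A \<subseteq> X" shows "A \<in> S"
proof -
  have "(\<Union>p\<in>A. {p}) \<in> S" using assms by (intro S.countable_UN') (auto intro: singleton_in_S)
  thus ?thesis by simp
qed

text \<open>Only countably many points are added, and singletons are measurable. So the sigma-algebra of
\<open>I\<^sup>*\<close> is determined by the trace on \<open>I\<close>, where it is the Borel
sigma-algebra.\<close>

lemma in_S_iff: "A \<in> S \<longleftrightarrow> A \<subseteq> X \<and> {x \<in> unit_I. Plus x \<in> A} \<in> sets borel"
proof
  assume A: "A \<in> S"
  have "{x \<in> unit_I. Plus x \<in> A} \<in> sets borel" using A
  proof (induction rule: sigma_sets.induct)
    case (Basic U)
    show ?case
    proof (rule borel_if_right_open)
      fix x assume x: "x \<in> {x \<in> unit_I. Plus x \<in> U}"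
      then obtain e where e: "0 < e" "\<forall>r\<in>X. Plus x \<le> r \<and> base r < x + e \<longrightarrow> r \<in> U"
        using right_nbhd[of U x] Basic by blast
      have "Plus y \<in> U" if y: "y \<in> {x..<x + min e (1 - x)}" for y
      proof -
        have "Plus x \<le> Plus y" using y by (auto simp: less_eq_split_point_def Plus_less_iff)
        moreover have "Plus y \<in> X" "base (Plus y) < x + e" using x y by auto
        ultimately show ?thesis using e(2) by blast
      qed
      thus "\<exists>e>0. {x..<x + e} \<subseteq> {x \<in> unit_I. Plus x \<in> U}"
        using x \<open>0 < e\<close> by (intro exI[of _ "min e (1 - x)"]) auto
    qed
  next
    case (Compl A)
    have "{x \<in> unit_I. Plus x \<in> X - A} = unit_I - {x \<in> unit_I. Plus x \<in> A}" by auto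
    thus ?case using Compl.IH by simp
  next
    case (Union A)
    have "{x \<in> unit_I. Plus x \<in> \<Union> (range A)} = (\<Union>n. {x \<in> unit_I. Plus x \<in> A n})" by auto
    thus ?case using Union.IH by simp
  qed simp
  thus "A \<subseteq> X \<and> {x \<in> unit_I. Plus x \<in> A} \<in> sets borel"
    using S.sets_into_space[OF A] by simp
next
  assume A: "A \<subseteq> X \<and> {x \<in> unit_I. Plus x \<in> A} \<in> sets borel"
  have "{p \<in> X. base p \<in> {x \<in> unit_I. Plus x \<in> A}} - added_points \<in> S"
    using A by (intro S.Diff base_vimage_in_S countable_in_S countable_added_points)
      (auto simp: added_points_def)
  moreover have "A \<inter> added_points \<in> S"
    using countable_added_points A by (intro countable_in_S) (auto intro: countable_subset[rotated])
  ultimately have "({p \<in> X. base p \<in> {x \<in> unit_I. Plus x \<in> A}} - added_points) \<union> (A \<inter> added_points) \<in> S"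
    by (rule S.Un)
  also have "({p \<in> X. base p \<in> {x \<in> unit_I. Plus x \<in> A}} - added_points) \<union> (A \<inter> added_points) = A"
  proof -
    have "p \<in> ({p \<in> X. base p \<in> {x \<in> unit_I. Plus x \<in> A}} - added_points) \<union> (A \<inter> added_points)
        \<longleftrightarrow> p \<in> A" for p
    proof (cases p)
      case (Plus x)
      have "p \<notin> added_points" by (auto simp: added_points_def Plus)
      moreover have "p \<in> A \<Longrightarrow> x \<in> unit_I" using A Plus by (metis Plus_in_X_iff subsetD)
      ultimately show ?thesis by (simp add: Plus) blast
    next
      case (Minus z)
      have "p \<in> X \<Longrightarrow> p \<in> added_points" by (auto simp: added_points_def Minus)
      thus ?thesis using A by blast
    qed
    thus ?thesis by (rule set_eqI)
  qed
  finally show "A \<in> S" .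
qed

definition image_measure :: "split_point measure" where
  "image_measure = distr (restrict_space lborel unit_I) (sigma X {U. openin T U}) Plus"

lemma space_image_measure [simp]: "space image_measure = X"
  using open_subsets_Pow by (simp add: image_measure_def space_measure_of)

lemma sets_image_measure [simp]: "sets image_measure = S"
  using open_subsets_Pow by (simp add: image_measure_def sets_measure_of)

lemma emeasure_image_measure:
  assumes "A \<in> S" shows "emeasure image_measure A = emeasure lborel {x \<in> unit_I. Plus x \<in> A}"
proof -
  have "Plus \<in> measurable (restrict_space lborel unit_I) (sigma X {U. openin T U})"
  proof (rule measurableI)
    fix B assume "B \<in> sets (sigma X {U. openin T U})"
    hence "{x \<in> unit_I. Plus x \<in> B} \<in> sets borel"
      using in_S_iff open_subsets_Pow by (simp add: sets_measure_of)
    moreover have "Plus -` B \<inter> space (restrict_space lborel unit_I) = {x \<in> unit_I. Plus x \<in> B}"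
      by (auto simp: space_restrict_space)
    ultimately show "Plus -` B \<inter> space (restrict_space lborel unit_I) \<in> sets (restrict_space lborel unit_I)"
      by (subst sets_restrict_space_iff) auto
  qed (use open_subsets_Pow in \<open>auto simp: space_measure_of space_restrict_space\<close>)
  hence "emeasure image_measure A = emeasure (restrict_space lborel unit_I) (Plus -` A \<inter> space (restrict_space lborel unit_I))"
    unfolding image_measure_def using assms open_subsets_Pow
    by (intro emeasure_distr) (auto simp: sets_measure_of)
  also have "Plus -` A \<inter> space (restrict_space lborel unit_I) = {x \<in> unit_I. Plus x \<in> A}"
    by (auto simp: space_restrict_space)
  also have "emeasure (restrict_space lborel unit_I) \<dots> = emeasure lborel \<dots>"
    by (rule emeasure_restrict_space) auto
  finally show ?thesis .
qed

lemma measure_image_measure: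
  "A \<in> S \<Longrightarrow> measure image_measure A = measure lborel {x \<in> unit_I. Plus x \<in> A}"
  by (simp only: measure_def emeasure_image_measure)

lemma F_star_vimage_in_S:
  assumes "A \<in> S" shows "Fs -` A \<inter> X \<in> S"
proof -
  have "{x \<in> unit_I. Plus x \<in> Fs -` A \<inter> X} = {x \<in> unit_I. F x \<in> {y \<in> unit_I. Plus y \<in> A}}"
    using F_unit_I by auto
  moreover have "{x \<in> unit_I. F x \<in> {y \<in> unit_I. Plus y \<in> A}} \<in> sets borel"
    using assms by (intro F_vimage_borel) (simp add: in_S_iff)
  ultimately show ?thesis by (simp add: in_S_iff)
qed

lemma invariant_prob_image_measure: "invariant_prob T Fs image_measure"
  unfolding invariant_prob_def topspace_T
proof (intro conjI)
  have "emeasure image_measure X = 1"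
  proof -
    have "{x \<in> unit_I. Plus x \<in> X} = unit_I" by auto
    thus ?thesis using emeasure_image_measure[OF S.top] by simp
  qed
  thus "prob_space image_measure" by (intro prob_spaceI) simp
  show F: "Fs \<in> measurable image_measure image_measure"
    by (rule measurableI) (auto simp: F_star_in_X F_star_vimage_in_S)
  show "distr image_measure image_measure Fs = image_measure"
  proof (rule measure_eqI)
    fix A assume "A \<in> sets (distr image_measure image_measure Fs)"
    hence A: "A \<in> S" by simp
    have "emeasure (distr image_measure image_measure Fs) A = emeasure image_measure (Fs -` A \<inter> X)"
      using A by (simp add: emeasure_distr[OF F])
    also have "\<dots> = emeasure lborel {x \<in> unit_I. Plus x \<in> Fs -` A \<inter> X}"
      by (rule emeasure_image_measure[OF F_star_vimage_in_S[OF A]])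
    also have "{x \<in> unit_I. Plus x \<in> Fs -` A \<inter> X} = {x \<in> unit_I. F x \<in> {y \<in> unit_I. Plus y \<in> A}}"
      using F_unit_I by auto
    also have "emeasure lborel \<dots> = emeasure lborel {y \<in> unit_I. Plus y \<in> A}"
      by (rule F_preserves_lebesgue) (use A in_S_iff in auto)
    also have "\<dots> = emeasure image_measure A" using emeasure_image_measure[OF A] by simp
    finally show "emeasure (distr image_measure image_measure Fs) A = emeasure image_measure A" .
  qed simp
qed auto

end

text \<open>Unique ergodicity on \<open>[0, 1)\<close>, phrased for Borel probability measures on the line
that are carried by \<open>[0, 1)\<close>.\<close>

definition lebesgue_only_invariant :: "(real \<Rightarrow> real) \<Rightarrow> bool" where
  "lebesgue_only_invariant f \<longleftrightarrow>
     (\<forall>\<nu>. prob_space \<nu> \<and> sets \<nu> = sets borel \<and> emeasure \<nu> unit_I = 1 \<and>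
        (\<forall>B\<in>sets borel. B \<subseteq> unit_I \<longrightarrow> emeasure \<nu> {x \<in> unit_I. f x \<in> B} = emeasure \<nu> B) \<longrightarrow>
        (\<forall>B\<in>sets borel. B \<subseteq> unit_I \<longrightarrow> emeasure \<nu> B = emeasure lborel B))"

context minimal_rotated
begin

text \<open>A finite orbit would be a closed invariant set, hence the whole infinite space.\<close>

lemma inj_orbit:
  assumes "p \<in> X" shows "inj (\<lambda>n. (Fs ^^ n) p)"
proof -
  have "(Fs ^^ n) p \<noteq> (Fs ^^ m) p" if "n < m" for n m
  proof
    assume eq: "(Fs ^^ n) p = (Fs ^^ m) p"
    define N where "N = (\<lambda>k. (Fs ^^ k) p) ` {..<m}"
    have "Fs ((Fs ^^ k) p) \<in> N" if "k < m" for k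
    proof (cases "Suc k < m")
      case True
      thus ?thesis unfolding N_def by (intro image_eqI[of _ _ "Suc k"]) auto
    next
      case False
      hence "Suc k = m" using that by simp
      hence "Fs ((Fs ^^ k) p) = (Fs ^^ n) p" using eq by auto
      thus ?thesis using \<open>n < m\<close> unfolding N_def by (intro image_eqI[of _ _ n]) auto
    qed
    hence "Fs ` N \<subseteq> N" by (auto simp: N_def)
    moreover have "N \<noteq> {}" using that by (auto simp: N_def)
    moreover have "closedin T N"
      by (rule closedin_Hausdorff_finite)
        (use funpow_F_star_in_X[OF assms] in \<open>auto simp: N_def top_star_def Hausdorff_order_topology_on\<close>)
    ultimately have "N = X" by (intro closed_invariant_eq_X)
    hence "finite (Plus ` unit_I)" unfolding N_def by (metis (no_types, lifting) finite_imageI finite_lessThan finite_subset I_star_def Un_upper1 Un_assoc)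
    hence "finite unit_I" by (rule finite_imageD) (auto intro: inj_onI)
    thus False using infinite_Ico[of 0 "1::real"] by simp
  qed
  thus ?thesis by (intro injI) (metis linorder_neqE_nat)
qed

text \<open>The mass of a point does not decrease along its orbit, and the orbit is infinite.\<close>

lemma invariant_prob_atomless:
  assumes \<mu>: "invariant_prob T Fs \<mu>" and p: "p \<in> X"
  shows "emeasure \<mu> {p} = 0"
proof -
  interpret \<mu>: prob_space \<mu> using \<mu> by (simp add: invariant_prob_def)
  have sp: "space \<mu> = X" and st: "sets \<mu> = S" and F: "Fs \<in> measurable \<mu> \<mu>" and inv: "distr \<mu> \<mu> Fs = \<mu>"
    using \<mu> by (auto simp: invariant_prob_def)
  have step: "measure \<mu> {r} \<le> measure \<mu> {Fs r}" if r: "r \<in> X" for r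
  proof -
    have s: "{Fs r} \<in> sets \<mu>" using singleton_in_S F_star_in_X[OF r] st by simp
    have "measure \<mu> {r} \<le> measure \<mu> (Fs -` {Fs r} \<inter> space \<mu>)"
      by (rule \<mu>.finite_measure_mono) (use r sp measurable_sets[OF F s] in auto)
    also have "\<dots> = measure (distr \<mu> \<mu> Fs) {Fs r}" using measure_distr[OF F s] by simp
    finally show ?thesis by (simp add: inv)
  qed
  have orbit: "measure \<mu> {p} \<le> measure \<mu> {(Fs ^^ n) p}" for n
  proof (induction n)
    case (Suc n)
    thus ?case using step[OF funpow_F_star_in_X[OF p, of n]] by simp
  qed simp
  have "real n * measure \<mu> {p} \<le> 1" for n
  proof -
    let ?A = "(\<lambda>k. (Fs ^^ k) p) ` {..<n}"
    have "real n * measure \<mu> {p} \<le> (\<Sum>k<n. measure \<mu> {(Fs ^^ k) p})"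
      using sum_bounded_below[of "{..<n}" "measure \<mu> {p}"] orbit by simp
    also have "\<dots> = (\<Sum>r\<in>?A. measure \<mu> {r})"
      using inj_on_subset[OF inj_orbit[OF p]] by (subst sum.reindex) auto
    also have "\<dots> = measure \<mu> ?A"
      by (rule \<mu>.finite_measure_eq_sum_singleton[symmetric])
        (use singleton_in_S funpow_F_star_in_X[OF p] st in auto)
    also have "\<dots> \<le> 1" by simp
    finally show ?thesis .
  qed
  hence "measure \<mu> {p} \<le> 0"
    by (meson not_le reals_Archimedean3)
  thus ?thesis by (simp add: \<mu>.emeasure_eq_measure measure_le_0_iff)
qed

text \<open>The countable set of added points is null because there are no atoms. On the remaining points the
projection to the line conjugates the extended map to \<open>F\<close>, so the projected measure is invariant
under \<open>F\<close>.\<close>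

lemma invariant_prob_unique:
  assumes \<mu>: "invariant_prob T Fs \<mu>" and unique: "lebesgue_only_invariant F"
  shows "\<mu> = image_measure"
proof -
  interpret \<mu>: prob_space \<mu> using \<mu> by (simp add: invariant_prob_def)
  have sp: "space \<mu> = X" and st: "sets \<mu> = S" and F: "Fs \<in> measurable \<mu> \<mu>" and inv: "distr \<mu> \<mu> Fs = \<mu>"
    using \<mu> by (auto simp: invariant_prob_def)
  have "(\<Union>p\<in>added_points. {p}) \<in> null_sets \<mu>"
    by (rule null_sets_UN') (use countable_added_points invariant_prob_atomless[OF \<mu>] singleton_in_S st
        in \<open>auto simp: added_points_def null_sets_def\<close>)
  hence null: "added_points \<in> null_sets \<mu>" by simp
  have Plus: "AE p in \<mu>. \<exists>x\<in>unit_I. p = Plus x"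
  proof (rule AE_I'[OF null])
    show "{p \<in> space \<mu>. \<not> (\<exists>x\<in>unit_I. p = Plus x)} \<subseteq> added_points"
    proof
      fix p assume "p \<in> {p \<in> space \<mu>. \<not> (\<exists>x\<in>unit_I. p = Plus x)}"
      thus "p \<in> added_points" by (cases p) (auto simp: sp added_points_def)
    qed
  qed
  have eq: "emeasure \<mu> {p \<in> X. P p} = emeasure \<mu> {p \<in> X. Q p}"
    if "{p \<in> X. P p} \<in> S" "{p \<in> X. Q p} \<in> S" "\<And>x. x \<in> unit_I \<Longrightarrow> P (Plus x) \<longleftrightarrow> Q (Plus x)" for P Q
  proof (rule emeasure_eq_AE)
    show "AE p in \<mu>. (p \<in> {p \<in> X. P p}) = (p \<in> {p \<in> X. Q p})"
      using Plus by (rule eventually_mono) (use that(3) in auto)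
  qed (use that st in auto)
  have base: "base \<in> borel_measurable \<mu>"
  proof (rule measurableI)
    fix B :: "real set" assume "B \<in> sets borel"
    from base_vimage_in_S[OF this] show "base -` B \<inter> space \<mu> \<in> sets \<mu>"
      by (simp add: sp st vimage_def Int_def conj_commute)
  qed simp
  define \<nu> where "\<nu> = distr \<mu> borel base"
  have \<nu>: "emeasure \<nu> B = emeasure \<mu> {p \<in> X. base p \<in> B}" if "B \<in> sets borel" for B
    using emeasure_distr[OF base that] by (simp add: \<nu>_def sp vimage_def Int_def conj_commute)
  have FX: "{p \<in> X. Fs p \<in> A} \<in> S" "emeasure \<mu> {p \<in> X. Fs p \<in> A} = emeasure \<mu> A" if "A \<in> S" for A
  proof -
    have "Fs -` A \<inter> X = {p \<in> X. Fs p \<in> A}" by auto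
    thus "{p \<in> X. Fs p \<in> A} \<in> S" "emeasure \<mu> {p \<in> X. Fs p \<in> A} = emeasure \<mu> A"
      using F_star_vimage_in_S[OF that] emeasure_distr[OF F, of A] that by (simp_all add: inv sp st)
  qed
  have "emeasure \<nu> B = emeasure lborel B" if "B \<in> sets borel" "B \<subseteq> unit_I" for B
  proof (rule unique[unfolded lebesgue_only_invariant_def, rule_format, OF _ that], intro conjI ballI impI)
    show "prob_space \<nu>" unfolding \<nu>_def by (rule \<mu>.prob_space_distr[OF base])
    show "sets \<nu> = sets borel" by (simp add: \<nu>_def)
    have I: "unit_I \<in> sets borel" by simp
    have "emeasure \<nu> unit_I = emeasure \<mu> {p \<in> X. True}"
      unfolding \<nu>[OF I] by (rule eq[OF base_vimage_in_S[OF I]]) (auto simp: S.top)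
    thus "emeasure \<nu> unit_I = 1" using \<mu>.emeasure_space_1 by (simp add: sp)
    fix B :: "real set" assume B: "B \<in> sets borel" "B \<subseteq> unit_I"
    have "emeasure \<nu> {x \<in> unit_I. F x \<in> B} = emeasure \<mu> {p \<in> X. base p \<in> {x \<in> unit_I. F x \<in> B}}"
      by (rule \<nu>[OF F_vimage_borel[OF B(1)]])
    also have "\<dots> = emeasure \<mu> {p \<in> X. Fs p \<in> {p \<in> X. base p \<in> B}}"
      by (rule eq[OF base_vimage_in_S[OF F_vimage_borel[OF B(1)]] FX(1)[OF base_vimage_in_S[OF B(1)]]])
        (use F_unit_I in auto)
    also have "\<dots> = emeasure \<nu> B" using FX(2)[OF base_vimage_in_S[OF B(1)]] \<nu>[OF B(1)] by simp
    finally show "emeasure \<nu> {x \<in> unit_I. F x \<in> B} = emeasure \<nu> B" .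
  qed
  note lebesgue = this
  show ?thesis
  proof (rule measure_eqI)
    fix A assume "A \<in> sets \<mu>"
    hence A: "A \<in> S" by (simp add: st)
    define B where "B = {x \<in> unit_I. Plus x \<in> A}"
    have B: "B \<in> sets borel" "B \<subseteq> unit_I" using A by (auto simp: B_def in_S_iff)
    have "A = {p \<in> X. p \<in> A}" using A S.sets_into_space by blast
    hence "emeasure \<mu> A = emeasure \<mu> {p \<in> X. p \<in> A}" by simp
    also have "\<dots> = emeasure \<mu> {p \<in> X. base p \<in> B}"
      by (rule eq) (use A \<open>A = {p \<in> X. p \<in> A}\<close> base_vimage_in_S[OF B(1)] in \<open>auto simp: B_def\<close>)
    also have "\<dots> = emeasure lborel B" using \<nu>[OF B(1)] lebesgue[OF B] by simp
    also have "\<dots> = emeasure image_measure A" using emeasure_image_measure[OF A] by (simp add: B_def)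
    finally show "emeasure \<mu> A = emeasure image_measure A" .
  qed (simp add: st)
qed

lemma mu_min_eq:
  assumes "lebesgue_only_invariant F" shows "mu_min q \<pi> = image_measure"
  unfolding mu_min_def top_min_eq
  using invariant_prob_image_measure invariant_prob_unique[OF _ assms] by (rule the_equality)

text \<open>For \<open>A = [0, 1/2)\<close> the measure of \<open>F\<^sup>-\<^sup>k A \<inter> A\<close>
alternates between \<open>1/2\<close> and \<open>0\<close>, so it always differs from \<open>1/4\<close> by
\<open>1/4\<close>.\<close>

lemma not_weakly_mixing_if_swaps_halves:
  assumes unique: "lebesgue_only_invariant F"
    and swap: "\<And>x. x \<in> unit_I \<Longrightarrow> F x < 1/2 \<longleftrightarrow> 1/2 \<le> x"
  shows "\<not> weakly_mixing (mu_min q \<pi>) Fs"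
proof
  assume mix: "weakly_mixing (mu_min q \<pi>) Fs"
  define A where "A = {p \<in> X. base p \<in> {..<1/2}}"
  have A: "A \<in> S" unfolding A_def by (rule base_vimage_in_S) simp
  have parity: "(F ^^ k) x < 1/2 \<longleftrightarrow> even k" if x: "x \<in> {0..<1/2}" for k x
  proof (induction k)
    case (Suc k)
    have "(F ^^ k) x \<in> unit_I" using funpow_F_unit_I x by simp
    thus ?case using swap[of "(F ^^ k) x"] Suc by auto
  qed (use x in simp)
  have \<mu>A: "measure image_measure A = 1/2"
  proof -
    have "{x \<in> unit_I. Plus x \<in> A} = {0..<1/2}" by (auto simp: A_def)
    thus ?thesis using measure_image_measure[OF A] by simp
  qed
  have overlap: "measure image_measure ((Fs ^^ k) -` A \<inter> A) = (if even k then 1/2 else 0)" for k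
  proof -
    have set: "{x \<in> unit_I. Plus x \<in> (Fs ^^ k) -` A \<inter> A} = (if even k then {0..<1/2} else {})"
    proof -
      have PA: "Plus y \<in> A \<longleftrightarrow> y \<in> {0..<1/2}" for y by (auto simp: A_def)
      have "(F ^^ k) x \<in> {0..<1/2} \<longleftrightarrow> even k" if "x \<in> {0..<1/2}" for x
      proof -
        have "0 \<le> (F ^^ k) x" using funpow_F_unit_I[of x k] that by auto
        thus ?thesis using parity[OF that, of k] unfolding atLeastLessThan_iff by blast
      qed
      moreover have "x \<in> unit_I" if "x \<in> {0..<1/2}" for x :: real using that by auto
      ultimately show ?thesis unfolding vimage_def Int_iff mem_Collect_eq funpow_F_star_Plus PA
        by (cases "even k") (simp only: if_True if_False; blast)+
    qed
    hence "(Fs ^^ k) -` A \<inter> A \<in> S" unfolding in_S_iff by (auto simp: A_def)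
    thus ?thesis using measure_image_measure set by simp
  qed
  have "(\<lambda>n. (\<Sum>k<n. \<bar>measure image_measure ((Fs ^^ k) -` A \<inter> A)
      - measure image_measure A * measure image_measure A\<bar>) / real n) \<longlonglongrightarrow> 0"
    using mix A unfolding mu_min_eq[OF unique] weakly_mixing_def by simp
  moreover have "\<And>k. \<bar>measure image_measure ((Fs ^^ k) -` A \<inter> A)
      - measure image_measure A * measure image_measure A\<bar> = 1/4"
    unfolding overlap \<mu>A by simp
  ultimately have lim: "(\<lambda>n. (real n * (1/4)) / real n) \<longlonglongrightarrow> 0"
    by (simp only: sum_constant card_lessThan)
  have "\<forall>\<^sub>F n in sequentially. (real n * (1/4)) / real n = 1/4"
    using eventually_gt_at_top[of 0] by eventually_elim simp
  hence "(\<lambda>n. (real n * (1/4)) / real n) \<longlonglongrightarrow> 1/4" by (rule tendsto_eventually)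
  from LIMSEQ_unique[OF lim this] show False by simp
qed

end

section \<open>An obstruction to the dyadic factor\<close>

text \<open>The two lowest digits count modulo 4, so every second step flips the digit of index 1.\<close>

lemma dyadic_odometer_funpow_even: "(dyadic_odometer ^^ (2 * n)) \<omega> 1 \<longleftrightarrow> (\<omega> 1 \<noteq> odd n)"
proof (induction n)
  case (Suc n)
  have "dyadic_odometer (dyadic_odometer \<eta>) 1 \<longleftrightarrow> \<not> \<eta> 1" for \<eta>
    by (auto simp: dyadic_odometer_def)
  thus ?case using Suc by simp
qed simp

context minimal_rotated
begin

text \<open>At a time congruent to 2 modulo 4 the second digit of the image is flipped. If the orbit of
\<open>0\<close> comes back arbitrarily close to \<open>0\<close> at such times, the second digit of the image
is not continuous at \<open>0\<close>.\<close>

lemma no_dyadic_factor_if_recurrent: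
  assumes recurrent: "\<And>e. 0 < e \<Longrightarrow> \<exists>m. (F ^^ (4 * m + 2)) 0 < e"
  shows "\<not> topological_factor (top_min q \<pi>) Fs cantor_topology dyadic_odometer"
proof
  assume "topological_factor (top_min q \<pi>) Fs cantor_topology dyadic_odometer"
  then obtain h where h: "continuous_map T cantor_topology h"
    "\<And>p. p \<in> X \<Longrightarrow> h (Fs p) = dyadic_odometer (h p)"
    unfolding topological_factor_def top_min_eq topspace_T by blast
  have "continuous_map T (discrete_topology UNIV) (\<lambda>p. h p 1)"
    using h(1) unfolding cantor_topology_def continuous_map_componentwise_UNIV by blast
  hence "openin T {p \<in> topspace T. h p 1 \<in> {h (Plus 0) 1}}"
    by (rule openin_continuous_map_preimage) simp
  hence open_cell: "openin T {p \<in> X. h p 1 = h (Plus 0) 1}" by simp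
  have "Plus 0 \<in> {p \<in> X. h p 1 = h (Plus 0) 1}" by simp
  from right_nbhd[OF open_cell this] obtain e where e: "0 < e"
    "\<forall>r\<in>X. Plus 0 \<le> r \<and> base r < 0 + e \<longrightarrow> r \<in> {p \<in> X. h p 1 = h (Plus 0) 1}"
    by blast
  obtain m where m: "(F ^^ (4 * m + 2)) 0 < e" using recurrent[OF e(1)] by blast
  define x where "x = (F ^^ (4 * m + 2)) 0"
  have x: "x \<in> unit_I" unfolding x_def by (rule funpow_F_unit_I) simp
  have "Plus 0 \<le> Plus x" using x by (auto simp: less_eq_split_point_def Plus_less_iff)
  moreover have "x < e" unfolding x_def by (rule m)
  hence "Plus x \<in> X" "base (Plus x) < 0 + e" using x by simp_all
  ultimately have "h (Plus x) 1 = h (Plus 0) 1" using e(2) by blast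
  moreover have "h ((Fs ^^ n) (Plus 0)) = (dyadic_odometer ^^ n) (h (Plus 0))" for n
  proof (induction n)
    case (Suc n)
    have "(Fs ^^ n) (Plus 0) \<in> X" by (rule funpow_F_star_in_X) simp
    from h(2)[OF this] show ?case using Suc by simp
  qed simp
  from this[of "4 * m + 2"] have "h (Plus x) = (dyadic_odometer ^^ (2 * (2 * m + 1))) (h (Plus 0))"
    unfolding funpow_F_star_Plus x_def[symmetric] by (simp only: algebra_simps) simp
  hence "h (Plus x) 1 \<longleftrightarrow> (h (Plus 0) 1 \<noteq> odd (2 * m + 1))"
    by (simp only: dyadic_odometer_funpow_even)
  ultimately show False by simp
qed

end

section \<open>A skyscraper over the odometer\<close>

text \<open>Cut \<open>[0, 1)\<close> into four quarters of \<open>r\<close> letters. The odometer visits the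
quarters in the order first, third, second, fourth. The letter \<open>2r\<close> is the second floor of the
first column, \<open>3r\<close> the top floor of the first column and \<open>4r - 1\<close> the top floor of
the last column.\<close>

definition detour :: "nat \<Rightarrow> nat \<Rightarrow> nat" where
  "detour r i = (if i = 2 * r then 3 * r else if i = 3 * r then 4 * r - 1
     else if i = 4 * r - 1 then 2 * r else i)"

lemma detour_permutes:
  assumes "2 \<le> r" shows "detour r permutes {..<4 * r}"
  unfolding permutes_def
proof (intro conjI allI impI)
  fix i assume "i \<notin> {..<4 * r}"
  thus "detour r i = i" using assms by (simp add: detour_def)
next
  fix y
  \<comment> \<open>The witness below is the inverse permutation.\<close>
  show "\<exists>!x. detour r x = y"
  proof (rule ex1I)
    show "detour r (if y = 3 * r then 2 * r else if y = 4 * r - 1 then 3 * r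
        else if y = 2 * r then 4 * r - 1 else y) = y" (is "detour r ?z = y")
    proof -
      have "4 * r - 1 \<noteq> 2 * r" "4 * r - 1 \<noteq> 3 * r" using assms by linarith+
      thus ?thesis using assms by (simp add: detour_def)
    qed
    show "x = ?z" if "detour r x = y" for x
      using that assms by (auto simp: detour_def split: if_splits)
  qed
qed

locale skyscraper =
  fixes r :: nat
  assumes r_ge: "3 \<le> r" and odd_r: "odd r"
begin

sublocale rotated "4 * r" "detour r"
  by standard (use detour_permutes r_ge in auto)

text \<open>The width of a letter.\<close>

definition d :: real where "d = 1 / (4 * real r)"

lemma d_bounds: "0 < d" "d \<le> 1/12"
  using r_ge by (auto simp: d_def field_simps)

lemma letter_bounds:
  "real (2 * r) / real (4 * r) = 1/2" "(real (2 * r) + 1) / real (4 * r) = 1/2 + d"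
  "real (3 * r) / real (4 * r) = 3/4" "(real (3 * r) + 1) / real (4 * r) = 3/4 + d"
  "real (4 * r - 1) / real (4 * r) = 1 - d" "(real (4 * r - 1) + 1) / real (4 * r) = 1"
  using r_ge by (auto simp: d_def field_simps of_nat_diff)

lemma rot_eq:
  assumes x: "x \<in> unit_I"
  shows "R x = (if 1/2 \<le> x \<and> x < 1/2 + d then x + 1/4
     else if 3/4 \<le> x \<and> x < 3/4 + d then x + 1/4 - d
     else if 1 - d \<le> x then x - 1/2 + d else x)"
proof -
  obtain i where i: "i < 4 * r" "real i / real (4 * r) \<le> x" "x < (real i + 1) / real (4 * r)"
    using letter_of[OF x] .
  have d: "detour r i = j \<Longrightarrow> R x = x + (real j / real (4 * r) - real i / real (4 * r))" for j
    using rot_on_letter[OF i(2,3)] by (simp add: diff_divide_distrib)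
  consider "i = 2 * r" | "i = 3 * r" | "i = 4 * r - 1" | "i \<noteq> 2 * r" "i \<noteq> 3 * r" "i \<noteq> 4 * r - 1"
    by blast
  thus ?thesis
  proof cases
    case 1
    have "detour r i = 3 * r" by (simp add: detour_def 1)
    from d[OF this] show ?thesis using i(2,3) d_bounds unfolding 1 letter_bounds by simp
  next
    case 2
    have "detour r i = 4 * r - 1" using r_ge by (simp add: detour_def 2)
    from d[OF this] show ?thesis using i(2,3) d_bounds unfolding 2 letter_bounds by simp
  next
    case 3
    have "4 * r - 1 \<noteq> 2 * r" "4 * r - 1 \<noteq> 3 * r" using r_ge by linarith+
    hence "detour r i = 2 * r" by (simp add: detour_def 3)
    from d[OF this] show ?thesis using i(2,3) d_bounds unfolding 3 letter_bounds by simp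
  next
    case 4
    have "\<not> (1/2 \<le> x \<and> x < 1/2 + d)" "\<not> (3/4 \<le> x \<and> x < 3/4 + d)" "\<not> (1 - d \<le> x \<and> x < 1)"
      using letter_unique[OF i(2,3), of "2 * r"] letter_unique[OF i(2,3), of "3 * r"]
        letter_unique[OF i(2,3), of "4 * r - 1"] 4 unfolding letter_bounds by blast+
    moreover have "detour r i = i" using 4 by (simp add: detour_def)
    ultimately show ?thesis using d[of i] x by auto
  qed
qed

text \<open>The odometer at scale \<open>1/4\<close> on the base \<open>[0, 1/4)\<close> of the tower.\<close>

definition base_map :: "real \<Rightarrow> real" where "base_map y = odo (4 * y) / 4"

lemma odo_middle: "1/2 \<le> x \<Longrightarrow> x < 3/4 \<Longrightarrow> odo x = x - 1/4"
  using odometer_on_cell[of 2 x] by (simp add: power2_eq_square)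

lemma odo_last: "y \<in> {0..<1/4} \<Longrightarrow> odo (y + 3/4) = base_map y"
proof -
  assume y: "y \<in> {0..<1/4}"
  have "odo (y + 3/4) = odo (2 * (y + 3/4) - 1) / 2" using y by (intro odometer_high') auto
  also have "2 * (y + 3/4) - 1 = 2 * y + 1/2" by simp
  also have "odo (2 * y + 1/2) = odo (2 * (2 * y + 1/2) - 1) / 2" using y by (intro odometer_high') auto
  also have "2 * (2 * y + 1/2) - 1 = 4 * y" by simp
  finally show ?thesis by (simp add: base_map_def)
qed

lemma F_eq_odo: "F x = odo (R x)"
  by (simp add: rotated_odometer_def)

lemma F_low: "x \<in> {0..<1/2} \<Longrightarrow> F x = x + 1/2"
  using rot_eq[of x] d_bounds odometer_low[of x] by (simp add: F_eq_odo)

lemma F_second: "y \<in> {d..<1/4} \<Longrightarrow> F (y + 1/2) = y + 1/4"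
  using rot_eq[of "y + 1/2"] d_bounds odo_middle[of "y + 1/2"] by (simp add: F_eq_odo)

lemma F_fourth: "y \<in> {1/4 - d..<1/4} \<Longrightarrow> F (y + 3/4) = y + d"
proof -
  assume y: "y \<in> {1/4 - d..<1/4}"
  have R: "R (y + 3/4) = y + 1/4 + d" using rot_eq[of "y + 3/4"] y d_bounds by simp
  have "odo (y + 1/4 + d) = y + 1/4 + d - 1/4" using y d_bounds by (intro odo_middle) auto
  thus ?thesis unfolding F_eq_odo R by simp
qed

lemma F_top:
  "y \<in> {0..<d} \<Longrightarrow> F (y + 1/2) = base_map y"
  "y \<in> {d..<1/4 - d} \<Longrightarrow> F (y + 3/4) = base_map y"
  "y \<in> {1/4 - d..<1/4} \<Longrightarrow> F (y + (d + 1/2)) = base_map y"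
proof -
  show "F (y + 1/2) = base_map y" if y: "y \<in> {0..<d}"
  proof -
    have R: "R (y + 1/2) = y + 3/4" using rot_eq[of "y + 1/2"] y d_bounds by simp
    have "y \<in> {0..<1/4}" using y d_bounds by auto
    from odo_last[OF this] show ?thesis unfolding F_eq_odo R .
  qed
  show "F (y + 3/4) = base_map y" if y: "y \<in> {d..<1/4 - d}"
  proof -
    have R: "R (y + 3/4) = y + 3/4" using rot_eq[of "y + 3/4"] y d_bounds by simp
    have "y \<in> {0..<1/4}" using y d_bounds by auto
    from odo_last[OF this] show ?thesis unfolding F_eq_odo R .
  qed
  show "F (y + (d + 1/2)) = base_map y" if y: "y \<in> {1/4 - d..<1/4}"
  proof -
    have R: "R (y + (d + 1/2)) = y + 3/4" using rot_eq[of "y + (d + 1/2)"] y d_bounds by simp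
    have "y \<in> {0..<1/4}" using y d_bounds by auto
    from odo_last[OF this] show ?thesis unfolding F_eq_odo R .
  qed
qed

text \<open>The return time to the base, that is, the height of the column: two for the first column, six for
the last one and four for the others.\<close>

definition roof :: "real \<Rightarrow> nat" where
  "roof y = (if y < d then 2 else if y < 1/4 - d then 4 else 6)"

text \<open>A triple \<open>(m, c, lo)\<close> describes one floor: it is the translate by \<open>c\<close> of
the part \<open>[lo, 1/4)\<close> of the base, and \<open>F\<^sup>m\<close> is this translation. The floors at
times 2 and 3 miss the first column, and those at times 4 and 5 exist over the last column only.\<close>

definition floors :: "(nat \<times> real \<times> real) set" where
  "floors = {(0, 0, 0), (1, 1/2, 0), (2, 1/4, d), (3, 3/4, d), (4, d, 1/4 - d), (5, d + 1/2, 1/4 - d)}"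

lemma funpow_F_small:
  "(F ^^ 2) y = F (F y)" "(F ^^ 3) y = F (F (F y))" "(F ^^ 4) y = F (F (F (F y)))"
  "(F ^^ 5) y = F (F (F (F (F y))))" "(F ^^ 6) y = F (F (F (F (F (F y)))))"
  by (simp_all add: eval_nat_numeral)

text \<open>The path of a base point through the floors, up to the floor from which it returns.\<close>

lemma F_climb:
  assumes y: "y \<in> {0..<1/4}"
  shows "F y = y + 1/2"
    "y \<in> {d..<1/4} \<Longrightarrow> F (F y) = y + 1/4"
    "y \<in> {d..<1/4} \<Longrightarrow> F (F (F y)) = y + 3/4"
    "y \<in> {1/4 - d..<1/4} \<Longrightarrow> F (F (F (F y))) = y + d"
    "y \<in> {1/4 - d..<1/4} \<Longrightarrow> F (F (F (F (F y)))) = y + (d + 1/2)"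
proof -
  show 1: "F y = y + 1/2" using y by (intro F_low) auto
  show 2: "F (F y) = y + 1/4" if "y \<in> {d..<1/4}" for y
    using F_low[of y] F_second[OF that] that d_bounds by simp
  show 3: "F (F (F y)) = y + 3/4" if "y \<in> {d..<1/4}" for y
    using F_low[of "y + 1/4"] 2[OF that] that d_bounds by simp
  show 4: "F (F (F (F y))) = y + d" if "y \<in> {1/4 - d..<1/4}" for y
    using F_fourth[OF that] 3[of y] that d_bounds by simp
  show "F (F (F (F (F y)))) = y + (d + 1/2)" if "y \<in> {1/4 - d..<1/4}" for y
    using F_low[of "y + d"] 4[OF that] that d_bounds by simp
qed

lemma F_roof:
  assumes y: "y \<in> {0..<1/4}" shows "(F ^^ roof y) y = base_map y"
proof -
  consider "y < d" | "d \<le> y" "y < 1/4 - d" | "d \<le> y" "1/4 - d \<le> y"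
    using d_bounds by linarith
  thus ?thesis
  proof cases
    case 1
    thus ?thesis using F_climb(1)[OF y] F_top(1)[of y] y by (simp add: roof_def funpow_F_small)
  next
    case 2
    thus ?thesis using F_climb(3)[OF y] F_top(2)[of y] y by (simp add: roof_def funpow_F_small)
  next
    case 3
    thus ?thesis using F_climb(5)[OF y] F_top(3)[of y] y by (simp add: roof_def funpow_F_small)
  qed
qed

lemma floor_translation:
  assumes "(m, c, lo) \<in> floors" "y \<in> {lo..<1/4}"
  shows "0 \<le> lo" "(F ^^ m) y = y + c" "m \<le> roof y" "y + c \<in> unit_I"
proof -
  have "y \<in> {0..<1/4}" using assms d_bounds by (auto simp: floors_def)
  note climb = F_climb[OF this]
  show "0 \<le> lo" "(F ^^ m) y = y + c" "m \<le> roof y" "y + c \<in> unit_I"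
    using assms d_bounds climb by (auto simp: floors_def roof_def funpow_F_small)
qed

lemma floors_cover:
  assumes "x \<in> unit_I" obtains m c lo where "(m, c, lo) \<in> floors" "x - c \<in> {lo..<1/4}"
proof -
  consider "x < 1/4" | "1/4 \<le> x" "x < 1/4 + d" | "1/4 + d \<le> x" "x < 1/2" | "1/2 \<le> x" "x < 3/4"
    | "3/4 \<le> x" "x < 3/4 + d" | "3/4 + d \<le> x"
    by linarith
  thus ?thesis
  proof cases
    case 1 thus ?thesis using assms by (intro that[of 0 0 0]) (auto simp: floors_def)
  next
    case 2 thus ?thesis using assms by (intro that[of 4 d "1/4 - d"]) (auto simp: floors_def)
  next
    case 3 thus ?thesis using assms by (intro that[of 2 "1/4" d]) (auto simp: floors_def)
  next
    case 4 thus ?thesis using assms by (intro that[of 1 "1/2" 0]) (auto simp: floors_def)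
  next
    case 5 thus ?thesis using assms by (intro that[of 5 "d + 1/2" "1/4 - d"]) (auto simp: floors_def)
  next
    case 6 thus ?thesis using assms by (intro that[of 3 "3/4" d]) (auto simp: floors_def)
  qed
qed

lemma base_map_in_base: "y \<in> {0..<1/4} \<Longrightarrow> base_map y \<in> {0..<1/4}"
  using odometer_unit_I[of "4 * y"] by (auto simp: base_map_def)

lemma funpow_base_map: "(base_map ^^ n) y = (odo ^^ n) (4 * y) / 4"
proof (induction n)
  case (Suc n)
  have "(base_map ^^ Suc n) y = base_map ((base_map ^^ n) y)" by simp
  also have "\<dots> = base_map ((odo ^^ n) (4 * y) / 4)" unfolding Suc ..
  also have "\<dots> = odo ((odo ^^ n) (4 * y)) / 4" unfolding base_map_def by simp
  finally show ?case by simp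
qed simp

lemma funpow_base_map_in_base: "y \<in> {0..<1/4} \<Longrightarrow> (base_map ^^ n) y \<in> {0..<1/4}"
proof (induction n)
  case (Suc n)
  from base_map_in_base[OF Suc.IH[OF Suc.prems]] show ?case by simp
qed simp

lemma F_return:
  "y \<in> {0..<1/4} \<Longrightarrow> (F ^^ (\<Sum>i<n. roof ((base_map ^^ i) y))) y = (base_map ^^ n) y"
proof (induction n)
  case (Suc n)
  have "(\<Sum>i<Suc n. roof ((base_map ^^ i) y)) = roof ((base_map ^^ n) y) + (\<Sum>i<n. roof ((base_map ^^ i) y))" by simp
  thus ?case using Suc F_roof[OF funpow_base_map_in_base[OF Suc.prems, of n]] by (simp only: funpow_add comp_apply funpow.simps)
qed simp

lemma roof_le_6: "roof y \<le> 6"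
  by (simp add: roof_def)

lemma reaches_base:
  assumes "x \<in> unit_I" obtains n where "n \<le> 6" "(F ^^ n) x \<in> {0..<1/4}"
proof -
  obtain m c lo where f: "(m, c, lo) \<in> floors" "x - c \<in> {lo..<1/4}" using floors_cover[OF assms] .
  define y where "y = x - c"
  have y: "y \<in> {0..<1/4}" "(F ^^ m) y = x" "m \<le> roof y"
    using floor_translation[OF f] f(2) by (auto simp: y_def)
  have "(F ^^ (roof y - m)) x = (F ^^ roof y) y"
    using funpow_add[of "roof y - m" m F] y(3) by (simp add: y(2)[symmetric])
  thus ?thesis using base_map_in_base[OF y(1)] F_roof[OF y(1)] roof_le_6[of y]
    by (intro that[of "roof y - m"]) auto
qed

lemma base_orbits_dense:
  assumes "0 \<le> u" "u < v" "v \<le> 1/4"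
  shows "\<exists>N. \<forall>y\<in>{0..<1/4}. \<exists>n\<le>N. (F ^^ n) y \<in> {u<..<v}"
proof -
  obtain N where N: "\<forall>x\<in>unit_I. \<exists>n\<le>N. (odo ^^ n) x \<in> {4 * u<..<4 * v}"
    using odometer_uniformly_dense[of "4 * u" "4 * v"] assms by auto
  have "\<exists>n\<le>6 * N. (F ^^ n) y \<in> {u<..<v}" if y: "y \<in> {0..<1/4}" for y
  proof -
    have "4 * y \<in> unit_I" using y by auto
    then obtain n where n: "n \<le> N" "(odo ^^ n) (4 * y) \<in> {4 * u<..<4 * v}" using N by blast
    have "(\<Sum>i<n. roof ((base_map ^^ i) y)) \<le> (\<Sum>i<n. 6)" by (intro sum_mono roof_le_6)
    also have "\<dots> \<le> 6 * N" using n(1) by simp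
    finally show ?thesis using F_return[OF y, of n] n(2)
      by (intro exI[of _ "\<Sum>i<n. roof ((base_map ^^ i) y)"]) (auto simp: funpow_base_map)
  qed
  thus ?thesis by blast
qed

sublocale minimal_rotated "4 * r" "detour r"
proof
  fix u v :: real assume uv: "0 \<le> u" "u < v" "v \<le> 1"
  obtain m c lo where f: "(m, c, lo) \<in> floors" "u - c \<in> {lo..<1/4}"
    using floors_cover[of u] uv by auto
  \<comment> \<open>Pull a piece of \<open>(u, v)\<close> that lies on one floor back to the base.\<close>
  define v' where "v' = min (v - c) (1/4)"
  have *: "0 \<le> u - c" "u - c < v'" "v' \<le> 1/4" "v' \<le> v - c"
  proof -
    show "v' \<le> 1/4" "v' \<le> v - c" unfolding v'_def by (rule min.cobounded2, rule min.cobounded1)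
    show "0 \<le> u - c" "u - c < v'" using floor_translation(1)[OF f] f(2) uv by (auto simp: v'_def)
  qed
  obtain N where N: "\<forall>y\<in>{0..<1/4}. \<exists>n\<le>N. (F ^^ n) y \<in> {u - c<..<v'}"
    using base_orbits_dense[OF *(1-3)] by blast
  have "\<exists>n\<le>m + N + 6. (F ^^ n) x \<in> {u<..<v}" if x: "x \<in> unit_I" for x
  proof -
    obtain k where k: "k \<le> 6" "(F ^^ k) x \<in> {0..<1/4}" using reaches_base[OF x] .
    then obtain n where n: "n \<le> N" "(F ^^ n) ((F ^^ k) x) \<in> {u - c<..<v'}" using N by blast
    define y where "y = (F ^^ n) ((F ^^ k) x)"
    have "y \<in> {lo..<1/4}" using n(2) f(2) * by (auto simp: y_def)
    hence "(F ^^ m) y = y + c" by (rule floor_translation(2)[OF f(1)])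
    hence "(F ^^ (m + n + k)) x = y + c" by (simp add: funpow_add y_def)
    moreover have "y + c \<in> {u<..<v}" using n(2) * by (auto simp: y_def)
    ultimately show ?thesis using n(1) k(1) by (intro exI[of _ "m + n + k"]) auto
  qed
  thus "\<exists>N. \<forall>x\<in>unit_I. \<exists>n\<le>N. (F ^^ n) x \<in> {u<..<v}" by blast
qed

text \<open>The rotation moves letters only inside the right half, and \<open>a\<close> exchanges the
halves.\<close>

lemma F_swaps_halves: "x \<in> unit_I \<Longrightarrow> F x < 1/2 \<longleftrightarrow> 1/2 \<le> x"
proof -
  assume x: "x \<in> unit_I"
  show ?thesis
  proof (cases "x < 1/2")
    case True
    thus ?thesis using x F_low[of x] by auto
  next
    case False
    have R: "R x \<in> unit_I" "1/2 \<le> R x"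
      using rot_unit_I[OF x] rot_eq[OF x] False d_bounds by auto
    have "odo (2 * R x - 1) \<in> unit_I" using R by (intro odometer_unit_I) auto
    thus ?thesis using False odometer_high'[of "R x"] R by (auto simp: F_eq_odo)
  qed
qed

text \<open>A form without subtraction, in natural numbers, of \<open>roof = 4 - 2 [first column] + 2 [last
column]\<close>.\<close>

lemma roof_at_dyadic:
  "roof (real j / 2 ^ k / 4) + 2 * of_bool (j * r < 2 ^ k) = 4 + 2 * of_bool (2 ^ k * (r - 1) \<le> j * r)"
proof -
  have r: "0 < real r" using r_ge by simp
  have 1: "real j / 2 ^ k / 4 < d \<longleftrightarrow> j * r < 2 ^ k"
  proof -
    have "real j / 2 ^ k / 4 < d \<longleftrightarrow> real (j * r) < real (2 ^ k)"
      using r by (simp add: d_def field_simps)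
    thus ?thesis by (simp only: of_nat_less_iff)
  qed
  have 2: "real j / 2 ^ k / 4 < 1/4 - d \<longleftrightarrow> j * r < 2 ^ k * (r - 1)"
  proof -
    have "real j / 2 ^ k / 4 < 1/4 - d \<longleftrightarrow> real (j * r) < real (2 ^ k * (r - 1))"
      using r r_ge by (simp add: d_def field_simps of_nat_diff)
    thus ?thesis by (simp only: of_nat_less_iff)
  qed
  have "2 ^ k * 1 \<le> 2 ^ k * (r - 1)" using r_ge by (intro mult_left_mono) auto
  hence "\<not> (j * r < 2 ^ k \<and> 2 ^ k * (r - 1) \<le> j * r)" by linarith
  thus ?thesis unfolding roof_def 1 2 by (auto simp: not_less)
qed

lemma not_dvd_power2: "\<not> r dvd 2 ^ k"
proof
  assume "r dvd 2 ^ k"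
  moreover have "coprime r (2 ^ k)" using odd_r by simp
  ultimately have "is_unit r" using coprime_absorb_left by blast
  thus False using r_ge by simp
qed

text \<open>The reflection \<open>j \<mapsto> 2\<^sup>k - j\<close> maps the visits \<open>j > 0\<close> to
the first column bijectively to the visits to the last one; \<open>j = 0\<close> is left over. The boundary
case \<open>j r = 2\<^sup>k\<close> does not occur since \<open>r\<close> does not divide
\<open>2\<^sup>k\<close>.\<close>

lemma sum_roof: "(\<Sum>i<2 ^ k. roof ((base_map ^^ i) 0)) = 4 * (2 ^ k - 1) + 2"
proof -
  define L where "L = {j. j < 2 ^ k \<and> j * r < 2 ^ k}"
  define H where "H = {j. j < 2 ^ k \<and> 2 ^ k * (r - 1) \<le> j * r}"
  have fin: "finite L" "finite H" by (simp_all add: L_def H_def)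
  have "real (\<Sum>i<2 ^ k. roof ((base_map ^^ i) 0)) = (\<Sum>i<2 ^ k. real (roof ((odo ^^ i) 0 / 4)))"
    by (simp add: funpow_base_map)
  also have "\<dots> = (\<Sum>j<2 ^ k. real (roof (real j / 2 ^ k / 4)))"
    by (rule sum_odometer_orbit)
  also have "\<dots> = real (\<Sum>j<2 ^ k. roof (real j / 2 ^ k / 4))" by simp
  finally have 1: "(\<Sum>i<2 ^ k. roof ((base_map ^^ i) 0)) = (\<Sum>j<2 ^ k. roof (real j / 2 ^ k / 4))"
    by (simp only: of_nat_eq_iff)
  have "(\<Sum>j<2 ^ k. roof (real j / 2 ^ k / 4)) + 2 * (\<Sum>j<2 ^ k. of_bool (j * r < 2 ^ k))
      = 4 * 2 ^ k + 2 * (\<Sum>j<2 ^ k. of_bool (2 ^ k * (r - 1) \<le> j * r))"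
    unfolding sum_distrib_left sum.distrib[symmetric] roof_at_dyadic
    by (simp add: sum.distrib)
  also have "(\<Sum>j<2 ^ k. of_bool (j * r < 2 ^ k)) = card L"
    by (simp add: L_def sum.If_cases of_bool_def Int_def lessThan_def)
  also have "(\<Sum>j<2 ^ k. of_bool (2 ^ k * (r - 1) \<le> j * r)) = card H"
    by (simp add: H_def sum.If_cases of_bool_def Int_def lessThan_def)
  finally have 2: "(\<Sum>j<2 ^ k. roof (real j / 2 ^ k / 4)) + 2 * card L = 4 * 2 ^ k + 2 * card H" .
  have flip: "2 ^ k * (r - 1) \<le> (2 ^ k - j) * r \<longleftrightarrow> j * r < 2 ^ k" if "j \<le> 2 ^ k" for j
  proof -
    have "(2 ^ k - j) * r = 2 ^ k * r - j * r" by (simp add: diff_mult_distrib)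
    moreover have "2 ^ k * (r - 1) = 2 ^ k * r - 2 ^ k" by (simp add: diff_mult_distrib2)
    moreover have "j * r \<le> 2 ^ k * r" using that by simp
    moreover have "2 ^ k * 1 \<le> 2 ^ k * r" using r_ge by (intro mult_left_mono) auto
    moreover have "j * r \<noteq> 2 ^ k" using not_dvd_power2[of k] by (metis dvd_triv_right)
    ultimately show ?thesis by linarith
  qed
  have "bij_betw (\<lambda>j. 2 ^ k - j) (L - {0}) H"
  proof (rule bij_betwI[of _ _ _ "\<lambda>j. 2 ^ k - j"])
    show "(\<lambda>j. 2 ^ k - j) \<in> L - {0} \<rightarrow> H" using flip by (auto simp: L_def H_def)
    show "(\<lambda>j. 2 ^ k - j) \<in> H \<rightarrow> L - {0}"
    proof
      fix j assume j: "j \<in> H"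
      hence "j < 2 ^ k" and "2 ^ k * (r - 1) \<le> j * r" by (auto simp: H_def)
      moreover from this have "(2 ^ k - j) * r < 2 ^ k" using flip[of "2 ^ k - j"] by simp
      moreover have "0 < j"
      proof (rule ccontr)
        assume "\<not> 0 < j"
        thus False using \<open>2 ^ k * (r - 1) \<le> j * r\<close> r_ge by simp
      qed
      ultimately show "2 ^ k - j \<in> L - {0}" by (auto simp: L_def)
    qed
  qed (auto simp: L_def H_def)
  hence "card (L - {0}) = card H" by (rule bij_betw_same_card)
  moreover have "0 \<in> L" by (simp add: L_def)
  ultimately have "card L = Suc (card H)" using fin by (metis card.remove)
  with 2 have "(\<Sum>j<2 ^ k. roof (real j / 2 ^ k / 4)) + 2 = 4 * 2 ^ k" by simp
  moreover have "1 \<le> (2::nat) ^ k" by simp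
  ultimately show ?thesis unfolding 1 by linarith
qed

text \<open>After \<open>2\<^sup>k\<close> returns the orbit of \<open>0\<close> is at
\<open>2\<^sup>-\<^sup>k / 8\<close>.\<close>

lemma recurrent:
  assumes "0 < \<epsilon>" shows "\<exists>m. (F ^^ (4 * m + 2)) 0 < \<epsilon>"
proof -
  obtain k where k: "(1/2::real) ^ k < \<epsilon>" using real_arch_pow_inv[OF assms, of "1/2"] by auto
  have "(F ^^ (4 * (2 ^ k - 1) + 2)) 0 = (base_map ^^ (2 ^ k)) 0"
    using F_return[of 0 "2 ^ k"] unfolding sum_roof by simp
  also have "\<dots> = odo 0 / 2 ^ k / 4"
    using odometer_renormalise[of 0 k] by (simp add: funpow_base_map)
  also have "\<dots> = (1/2) ^ k / 8"
  proof -
    have zero: "odo 0 = 1/2" using odometer_low[of 0] by simp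
    show ?thesis unfolding zero by (simp add: power_one_over)
  qed
  also have "\<dots> < \<epsilon>" 
  proof -
    have "(0::real) \<le> (1/2) ^ k" by simp
    thus ?thesis using k by linarith
  qed
  finally show ?thesis by blast
qed

theorem no_dyadic_factor:
  "\<not> topological_factor (top_min (4 * r) (detour r)) Fs cantor_topology dyadic_odometer"
  by (rule no_dyadic_factor_if_recurrent[OF recurrent])

end

section \<open>Unique ergodicity of the skyscraper\<close>

lemma funpow_odometer_translation:
  "n < 2 ^ k \<Longrightarrow> s \<in> {0..<1 / 2 ^ k} \<Longrightarrow> (odo ^^ n) s = (odo ^^ n) 0 + s"
proof (induction k arbitrary: n s)
  case (Suc k)
  have s: "2 * s \<in> {0..<1 / 2 ^ k}" using Suc.prems(2) by (auto simp: field_simps)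
  have "(1::real) / 2 ^ k \<le> 1" by simp
  hence s': "2 * s \<in> unit_I" using s less_le_trans[of "2 * s" "1 / 2 ^ k" 1] by auto
  have half: "2 * s / 2 = s" "(0::real) / 2 = 0" "(u + 2 * s) / 2 = u / 2 + s" for u
    by (simp_all add: add_divide_distrib)
  have zero: "(0::real) \<in> unit_I" by simp
  define m where "m = n div 2"
  have "m < 2 ^ k" using Suc.prems(1) by (auto simp: m_def)
  note IH = Suc.IH[OF this s]
  consider "n = 2 * m" | "n = 2 * m + 1" unfolding m_def by linarith
  thus ?case
  proof cases
    case 1
    show ?thesis
      using funpow_odometer_double[OF s', of m, unfolded IH half]
        funpow_odometer_double[OF zero, of m, unfolded half] unfolding 1 by metis
  next
    case 2
    have "(odo ^^ n) s = (odo ^^ m) 0 / 2 + s + 1/2"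
      unfolding 2 using funpow_odometer_double_Suc[OF s', of m, unfolded IH half] .
    moreover have "(odo ^^ n) 0 = (odo ^^ m) 0 / 2 + 1/2"
      unfolding 2 using funpow_odometer_double_Suc[OF zero, of m, unfolded half] .
    ultimately show ?thesis by linarith
  qed
qed simp

text \<open>An arbitrary invariant probability measure on \<open>[0, 1)\<close>, which turns out to be
Lebesgue measure.\<close>

locale invariant_real_measure = skyscraper +
  fixes \<nu> :: "real measure"
  assumes prob: "prob_space \<nu>" and sets_\<nu>: "sets \<nu> = sets borel"
    and unit: "emeasure \<nu> unit_I = 1"
    and invariant: "\<And>B. B \<in> sets borel \<Longrightarrow> B \<subseteq> unit_I \<Longrightarrow>
      emeasure \<nu> {x \<in> unit_I. F x \<in> B} = emeasure \<nu> B"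
begin

sublocale prob_space \<nu> by (rule prob)

abbreviation mass :: "real \<Rightarrow> real \<Rightarrow> real" where "mass a b \<equiv> measure \<nu> {a..<b}"

lemma funpow_invariant:
  "B \<in> sets borel \<Longrightarrow> B \<subseteq> unit_I \<Longrightarrow> {x \<in> unit_I. (F ^^ n) x \<in> B} \<in> sets borel
     \<and> emeasure \<nu> {x \<in> unit_I. (F ^^ n) x \<in> B} = emeasure \<nu> B"
proof (induction n)
  case 0
  hence "{x \<in> unit_I. x \<in> B} = B" by blast
  thus ?case using 0 by simp
next
  case (Suc n)
  let ?P = "{x \<in> unit_I. (F ^^ n) x \<in> B}"
  have "(F ^^ Suc n) x = (F ^^ n) (F x)" for x by (simp add: funpow_swap1)
  hence "{x \<in> unit_I. (F ^^ Suc n) x \<in> B} = {x \<in> unit_I. F x \<in> ?P}"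
    using F_unit_I by (auto simp del: funpow.simps)
  moreover have P: "?P \<in> sets borel" "emeasure \<nu> ?P = emeasure \<nu> B" "?P \<subseteq> unit_I"
    using Suc by blast+
  ultimately show ?case using F_vimage_borel[OF P(1)] invariant[OF P(1,3)] by (simp del: funpow.simps)
qed

text \<open>By injectivity the preimage under \<open>F\<^sup>n\<close> of the translated interval is the
original interval.\<close>

lemma mass_translate:
  assumes "{a..<b} \<subseteq> unit_I" "\<And>y. y \<in> {a..<b} \<Longrightarrow> (F ^^ n) y = y + c"
  shows "mass (a + c) (b + c) = mass a b"
proof -
  have sub: "{a + c..<b + c} \<subseteq> unit_I"
  proof
    fix x assume "x \<in> {a + c..<b + c}"
    hence "x - c \<in> {a..<b}" by auto
    hence "(F ^^ n) (x - c) = x" "x - c \<in> unit_I" using assms(2)[of "x - c"] assms(1) by auto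
    thus "x \<in> unit_I" using funpow_F_unit_I[of "x - c" n] by simp
  qed
  have "{x \<in> unit_I. (F ^^ n) x \<in> {a + c..<b + c}} = {a..<b}"
  proof (intro set_eqI iffI)
    fix x assume x: "x \<in> {x \<in> unit_I. (F ^^ n) x \<in> {a + c..<b + c}}"
    define y where "y = (F ^^ n) x - c"
    have y: "y \<in> {a..<b}" using x by (auto simp: y_def)
    hence "(F ^^ n) y = (F ^^ n) x" using assms(2)[of y] by (simp add: y_def)
    moreover have "y \<in> unit_I" "x \<in> unit_I" using y assms(1) x by blast+
    ultimately have "y = x" by (rule inj_onD[OF inj_on_funpow_F])
    thus "x \<in> {a..<b}" using y by simp
  next
    fix x assume x: "x \<in> {a..<b}"
    have "(F ^^ n) x = x + c" "x \<in> unit_I" using assms x by blast+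
    thus "x \<in> {x \<in> unit_I. (F ^^ n) x \<in> {a + c..<b + c}}" using x by simp
  qed
  thus ?thesis using funpow_invariant[of "{a + c..<b + c}" n] sub by (simp add: measure_def)
qed

lemma mass_split: "a \<le> m \<Longrightarrow> m \<le> b \<Longrightarrow> mass a b = mass a m + mass m b"
proof -
  assume m: "a \<le> m" "m \<le> b"
  have "measure \<nu> ({a..<m} \<union> {m..<b}) = mass a m + mass m b"
    by (rule finite_measure_Union) (auto simp: sets_\<nu>)
  moreover have "{a..<m} \<union> {m..<b} = {a..<b}" using m by auto
  ultimately show ?thesis by simp
qed

text \<open>Cut the interval at the column boundaries; on each piece the return to the base is a fixed iterate
of \<open>F\<close>.\<close>

lemma mass_translate_base_map:
  assumes "0 \<le> a" "a \<le> b" "b \<le> 1/4" "\<And>y. y \<in> {a..<b} \<Longrightarrow> base_map y = y + c"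
  shows "mass (a + c) (b + c) = mass a b"
proof -
  \<comment> \<open>The column boundaries \<open>d\<close> and \<open>1/4 - d\<close>, clipped to \<open>[a, b]\<close>.\<close>
  define m1 m2 where "m1 = max a (min b d)" and "m2 = max m1 (min b (1/4 - d))"
  have m: "a \<le> m1" "m1 \<le> m2" "m2 \<le> b" using assms(2) by (auto simp: m1_def m2_def)
  have piece: "mass (u + c) (v + c) = mass u v"
    if "a \<le> u" "u \<le> v" "v \<le> b" "\<And>y. y \<in> {u..<v} \<Longrightarrow> roof y = n" for u v n
  proof (rule mass_translate)
    show "{u..<v} \<subseteq> unit_I" using that assms by auto
    fix y assume y: "y \<in> {u..<v}"
    have "y \<in> {0..<1/4}" "y \<in> {a..<b}" using y that(1-3) assms by auto
    thus "(F ^^ n) y = y + c" using F_roof[of y] that(4)[OF y] assms(4)[of y] by simp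
  qed
  have "mass (a + c) (m1 + c) = mass a m1"
    by (rule piece[of a m1 2]) (use m in \<open>auto simp: roof_def m1_def\<close>)
  moreover have "mass (m1 + c) (m2 + c) = mass m1 m2"
    by (rule piece[of m1 m2 4]) (use m in \<open>auto simp: roof_def m1_def m2_def\<close>)
  moreover have "mass (m2 + c) (b + c) = mass m2 b"
    by (rule piece[of m2 b 6]) (use m d_bounds in \<open>auto simp: roof_def m1_def m2_def\<close>)
  ultimately show ?thesis
    using mass_split[of a m1 b] mass_split[of m1 m2 b] mass_split[of "a + c" "m1 + c" "b + c"]
      mass_split[of "m1 + c" "m2 + c" "b + c"] m by simp
qed

text \<open>The dyadic intervals of level \<open>k\<close> in the base follow each other under the base map,
so they have equal mass.\<close>

lemma mass_orbit_cell:
  "n < 2 ^ k \<Longrightarrow> mass ((odo ^^ n) 0 / 4) ((odo ^^ n) 0 / 4 + 1 / 2 ^ k / 4) = mass 0 (1 / 2 ^ k / 4)"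
proof (induction n)
  case (Suc n)
  define a b :: real where "a = (odo ^^ n) 0" and "b = (odo ^^ Suc n) 0"
  have a: "a \<in> unit_I" unfolding a_def by (rule funpow_odometer_unit_I) simp
  \<comment> \<open>Otherwise the iterate would translate a point of the cell to \<open>1\<close>, outside of \<open>[0, 1)\<close>.\<close>
  have end_le: "a + 1 / 2 ^ k \<le> 1"
  proof (rule ccontr)
    assume "\<not> a + 1 / 2 ^ k \<le> 1"
    hence s: "1 - a \<in> {0..<1 / 2 ^ k}" using a by auto
    have "(1::real) / 2 ^ k \<le> 1" by simp
    hence "1 - a \<in> unit_I" using s unfolding atLeastLessThan_iff by linarith
    from funpow_odometer_unit_I[OF this, of n] funpow_odometer_translation[OF _ s, of n] Suc.prems
    show False by (simp add: a_def)
  qed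
  have "base_map y = y + (b - a) / 4" if y: "y \<in> {a / 4..<a / 4 + 1 / 2 ^ k / 4}" for y
  proof -
    define s where "s = 4 * y - a"
    have s: "s \<in> {0..<1 / 2 ^ k}" using y by (auto simp: s_def)
    have "4 * y = (odo ^^ n) s"
      using funpow_odometer_translation[OF _ s, of n] Suc.prems by (simp add: s_def a_def)
    hence "odo (4 * y) = (odo ^^ Suc n) s" by simp
    also have "\<dots> = b + s" unfolding b_def by (rule funpow_odometer_translation[OF Suc.prems s])
    finally show ?thesis by (simp add: base_map_def s_def diff_divide_distrib)
  qed
  hence translate: "mass (a / 4 + (b - a) / 4) (a / 4 + 1 / 2 ^ k / 4 + (b - a) / 4) = mass (a / 4) (a / 4 + 1 / 2 ^ k / 4)"
    using a end_le by (intro mass_translate_base_map) auto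
  have shift: "a / 4 + (b - a) / 4 = b / 4" "a / 4 + 1 / 2 ^ k / 4 + (b - a) / 4 = b / 4 + 1 / 2 ^ k / 4"
    by (simp_all add: diff_divide_distrib)
  have "mass (a / 4) (a / 4 + 1 / 2 ^ k / 4) = mass 0 (1 / 2 ^ k / 4)"
    unfolding a_def using Suc.prems by (intro Suc.IH) simp
  thus ?case using translate unfolding shift b_def[symmetric] by (rule trans[rotated])
qed simp

lemma mass_dyadic: "j \<le> 2 ^ k \<Longrightarrow> mass 0 (real j / 2 ^ k / 4) = real j * mass 0 (1 / 2 ^ k / 4)"
proof (induction j)
  case (Suc j)
  obtain n where n: "n < 2 ^ k" "(odo ^^ n) 0 = real j / 2 ^ k + 0"
    using odometer_reaches_dyadic_cell[of j k] Suc.prems by force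
  have "real (Suc j) / 2 ^ k / 4 = real j / 2 ^ k / 4 + 1 / 2 ^ k / 4"
    by (simp add: add_divide_distrib)
  hence "mass 0 (real (Suc j) / 2 ^ k / 4) = mass 0 (real j / 2 ^ k / 4) + mass 0 (1 / 2 ^ k / 4)"
    using mass_split[of 0 "real j / 2 ^ k / 4" "real (Suc j) / 2 ^ k / 4"] mass_orbit_cell[OF n(1)] n(2) by simp
  thus ?case using Suc by (simp add: algebra_simps)
qed simp

definition density_const :: real where "density_const = 4 * mass 0 (1/4)"

lemma mass_cell: "mass 0 (1 / 2 ^ k / 4) = density_const / 4 / 2 ^ k"
  using mass_dyadic[of "2 ^ k" k] by (simp add: density_const_def field_simps)

text \<open>Equal mass of dyadic intervals determines the distribution function up to an error of one interval
of level \<open>k\<close>, for every \<open>k\<close>.\<close>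

lemma mass_base:
  assumes t: "0 \<le> t" "t \<le> 1/4" shows "mass 0 t = density_const * t"
proof (cases "t = 1/4")
  case False
  have bound: "\<bar>mass 0 t - density_const * t\<bar> \<le> density_const / 4 * (1/2) ^ k" for k
  proof -
    have "4 * t \<in> unit_I" using t False by auto
    then obtain j :: nat and s where j: "j < 2 ^ k" "s \<in> {0..<1 / 2 ^ k}" "4 * t = j / 2 ^ k + s"
      using dyadic_cell_of[of "4 * t" k] by blast
    have tj: "real j / 2 ^ k / 4 \<le> t" "t \<le> real (Suc j) / 2 ^ k / 4"
      using j by (auto simp: add_divide_distrib)
    have "mass 0 (real j / 2 ^ k / 4) \<le> mass 0 t" "mass 0 t \<le> mass 0 (real (Suc j) / 2 ^ k / 4)"
      by (rule finite_measure_mono; use tj in \<open>auto simp: sets_\<nu>\<close>)+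
    hence "real j * (density_const / 4 / 2 ^ k) \<le> mass 0 t" "mass 0 t \<le> real (Suc j) * (density_const / 4 / 2 ^ k)"
      using mass_dyadic[of j k] mass_dyadic[of "Suc j" k] j(1) unfolding mass_cell by auto
    moreover have "0 \<le> density_const" by (simp add: density_const_def)
    hence "density_const * (real j / 2 ^ k / 4) \<le> density_const * t" "density_const * t \<le> density_const * (real (Suc j) / 2 ^ k / 4)"
      by (rule mult_left_mono[OF tj(1)], rule mult_left_mono[OF tj(2)])
    ultimately have "\<bar>mass 0 t - density_const * t\<bar> \<le> density_const / 4 / 2 ^ k"
      by (simp add: algebra_simps add_divide_distrib)
    thus ?thesis by (simp add: power_one_over)
  qed
  have lim: "(\<lambda>k. density_const / 4 * (1/2) ^ k) \<longlonglongrightarrow> 0"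
    by (intro tendsto_mult_right_zero LIMSEQ_realpow_zero) auto
  have "\<bar>mass 0 t - density_const * t\<bar> \<le> 0" by (rule LIMSEQ_le_const[OF lim]) (use bound in blast)
  thus ?thesis by simp
next
  case True
  show ?thesis unfolding True density_const_def by simp
qed

text \<open>A floor has the mass distribution of the part of the base below it, so linearity extends across
the floor.\<close>

lemma mass_extend:
  assumes floor: "(m, c, lo) \<in> floors"
    and below: "\<And>t. 0 \<le> t \<Longrightarrow> t \<le> lo + c \<Longrightarrow> mass 0 t = density_const * t"
    and t: "0 \<le> t" "t \<le> 1/4 + c"
  shows "mass 0 t = density_const * t"
proof (cases "t \<le> lo + c")
  case False
  have lo: "0 \<le> lo" "lo \<le> 1/4" "0 \<le> lo + c" using floor d_bounds by (auto simp: floors_def)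
  have "mass (lo + c) ((t - c) + c) = mass lo (t - c)"
    by (rule mass_translate[where n = m]) (use floor_translation(2)[OF floor] lo t in auto)
  moreover have "mass 0 (t - c) = mass 0 lo + mass lo (t - c)" using lo False by (intro mass_split) auto
  moreover have "mass 0 t = mass 0 (lo + c) + mass (lo + c) t" using lo False by (intro mass_split) auto
  ultimately show ?thesis using mass_base[of lo] mass_base[of "t - c"] below[of "lo + c"] lo t False
    by (simp add: algebra_simps)
qed (use below t in auto)

text \<open>The six floors from left to right.\<close>

lemma mass_linear:
  assumes "0 \<le> t" "t \<le> 1" shows "mass 0 t = density_const * t"
proof -
  have 1: "mass 0 t = density_const * t" if "0 \<le> t" "t \<le> 1/4 + d" for t
    by (rule mass_extend[of 4 d "1/4 - d"]) (use that mass_base in \<open>auto simp: floors_def\<close>)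
  have 2: "mass 0 t = density_const * t" if "0 \<le> t" "t \<le> 1/2" for t
    by (rule mass_extend[of 2 "1/4" d]) (use that 1 in \<open>auto simp: floors_def\<close>)
  have 3: "mass 0 t = density_const * t" if "0 \<le> t" "t \<le> 3/4" for t
    by (rule mass_extend[of 1 "1/2" 0]) (use that 2 in \<open>auto simp: floors_def\<close>)
  have 4: "mass 0 t = density_const * t" if "0 \<le> t" "t \<le> 3/4 + d" for t
    by (rule mass_extend[of 5 "d + 1/2" "1/4 - d"]) (use that 3 in \<open>auto simp: floors_def\<close>)
  show ?thesis
    by (rule mass_extend[of 3 "3/4" d]) (use assms 4 in \<open>auto simp: floors_def\<close>)
qed

lemma mass_eq: "0 \<le> t \<Longrightarrow> t \<le> 1 \<Longrightarrow> mass 0 t = t"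
proof -
  have "density_const = 1" using mass_linear[of 1] unit by (simp add: measure_def)
  thus "0 \<le> t \<Longrightarrow> t \<le> 1 \<Longrightarrow> mass 0 t = t" using mass_linear[of t] by simp
qed

lemma AE_unit: "AE x in \<nu>. x \<in> unit_I"
proof -
  have "prob unit_I = 1" using unit by (simp add: measure_def)
  thus ?thesis by (subst (asm) prob_eq_1) (auto simp: sets_\<nu>)
qed

lemma \<nu>_eq_uniform: "\<nu> = uniform_measure lborel unit_I"
proof (rule measure_eqI_lessThan)
  fix x :: real
  define clamp :: "real \<Rightarrow> real" where "clamp x = max 0 (min 1 x)" for x
  have less: "prob {..<x} = clamp x" for x
  proof -
    have "prob {..<x} = mass 0 (clamp x)"
    proof (rule finite_measure_eq_AE)
      show "AE y in \<nu>. (y \<in> {..<x}) = (y \<in> {0..<clamp x})"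
        using AE_unit by (rule eventually_mono) (auto simp: clamp_def)
    qed (auto simp: sets_\<nu>)
    also have "\<dots> = clamp x" by (rule mass_eq) (auto simp: clamp_def)
    finally show ?thesis .
  qed
  have "prob {..x} = clamp x"
  proof (rule antisym)
    have "prob {..<x} \<le> prob {..x}" by (rule finite_measure_mono) (auto simp: sets_\<nu>)
    thus "clamp x \<le> prob {..x}" by (simp add: less)
    show "prob {..x} \<le> clamp x"
    proof (rule field_le_epsilon)
      fix h :: real assume "0 < h"
      hence "prob {..x} \<le> prob {..<x + h}" by (intro finite_measure_mono) (auto simp: sets_\<nu>)
      also have "\<dots> \<le> clamp x + h" using \<open>0 < h\<close> by (auto simp: less clamp_def)
      finally show "prob {..x} \<le> clamp x + h" .
    qed
  qed
  moreover have "prob (space \<nu> - {..x}) = 1 - prob {..x}" by (rule prob_compl) (simp add: sets_\<nu>)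
  moreover have "space \<nu> - {..x} = {x<..}" using sets_eq_imp_space_eq[OF sets_\<nu>] by auto
  ultimately have "emeasure \<nu> {x<..} = ennreal (1 - clamp x)" by (simp add: emeasure_eq_measure)
  moreover have "emeasure (uniform_measure lborel unit_I) {x<..} = emeasure lborel (unit_I \<inter> {x<..})"
    by (subst emeasure_uniform_measure) (auto simp: divide_ennreal_def)
  moreover have "emeasure lborel (unit_I \<inter> {x<..}) = ennreal (1 - clamp x)"
  proof (cases "x < 0")
    case True
    hence "unit_I \<inter> {x<..} = unit_I" by auto
    thus ?thesis using True by (simp add: clamp_def)
  next
    case False
    hence "unit_I \<inter> {x<..} = {x<..<1}" by auto
    thus ?thesis using False by (cases "x \<le> 1") (auto simp: clamp_def)
  qed
  ultimately show "emeasure \<nu> {x<..} = emeasure (uniform_measure lborel unit_I) {x<..}" by simp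
  show "emeasure \<nu> {x<..} < \<infinity>" by (simp add: emeasure_eq_measure)
qed (simp_all add: sets_\<nu>)

end

context skyscraper
begin

lemma lebesgue_only_invariant_F: "lebesgue_only_invariant F"
  unfolding lebesgue_only_invariant_def
proof (intro allI impI ballI)
  fix \<nu> :: "real measure" and B :: "real set"
  assume \<nu>: "prob_space \<nu> \<and> sets \<nu> = sets borel \<and> emeasure \<nu> unit_I = 1 \<and>
    (\<forall>B\<in>sets borel. B \<subseteq> unit_I \<longrightarrow> emeasure \<nu> {x \<in> unit_I. F x \<in> B} = emeasure \<nu> B)"
  interpret invariant_real_measure r \<nu>
    by (intro invariant_real_measure.intro invariant_real_measure_axioms.intro skyscraper_axioms) (use \<nu> in blast)+
  assume B: "B \<in> sets borel" "B \<subseteq> unit_I"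
  have "emeasure \<nu> B = emeasure (uniform_measure lborel unit_I) B" by (simp only: \<nu>_eq_uniform)
  also have "\<dots> = emeasure lborel (unit_I \<inter> B)"
    using B by (subst emeasure_uniform_measure) (auto simp: divide_ennreal_def)
  also have "unit_I \<inter> B = B" using B by blast
  finally show "emeasure \<nu> B = emeasure lborel B" .
qed

theorem not_weakly_mixing:
  "\<not> weakly_mixing (mu_min (4 * r) (detour r)) Fs"
  by (rule not_weakly_mixing_if_swaps_halves[OF lebesgue_only_invariant_F F_swaps_halves])

end

section \<open>Both families\<close>

theorem theorem1p7:
  shows "infinite {q::nat. q \<ge> 3 \<and>
           (\<exists>\<pi>. \<pi> permutes {..<q} \<and>
              topological_factor (top_min q \<pi>) (F_star q \<pi>) cantor_topology dyadic_odometer)}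
       \<and> infinite {q::nat. q \<ge> 3 \<and>
           (\<exists>\<pi>. \<pi> permutes {..<q} \<and>
              \<not> topological_factor (top_min q \<pi>) (F_star q \<pi>) cantor_topology dyadic_odometer \<and>
              \<not> weakly_mixing (mu_min q \<pi>) (F_star q \<pi>))}"
    (is "infinite ?A \<and> infinite ?B")
proof
  have "q \<in> ?A" if "3 \<le> q" for q
  proof -
    interpret unrotated q
      by standard (use that permutes_id in auto)
    show ?thesis using factor_onto_dyadic_odometer perm that by blast
  qed
  hence "{3..} \<subseteq> ?A" by auto
  thus "infinite ?A" using infinite_Ici infinite_super by blast
  have "4 * (2 * n + 3) \<in> ?B" for n
  proof -
    interpret skyscraper "2 * n + 3" by standard auto
    show ?thesis using no_dyadic_factor not_weakly_mixing perm by auto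
  qed
  hence "range (\<lambda>n. 4 * (2 * n + 3)) \<subseteq> ?B" by blast
  moreover have "infinite (range (\<lambda>n::nat. 4 * (2 * n + 3)))"
    by (rule range_inj_infinite) (auto intro: injI)
  ultimately show "infinite ?B" using infinite_super by blast
qed

end
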